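(* Let $\mathbb{K}$ be a field of characteristic zero, let $A\in\mathbb{K}^{n\times n}$, and suppose that the irreducible factorization $\chi_A(\lambda)=f_1(\lambda)^{m_1}\cdots f_q(\lambda)^{m_q}$ of its characteristic polynomial is given. Then Algorithm M (described in the context) outputs its result (the exponents $r_{i,j}$ of the factors of the unit minimal annihilating polynomials of $A$) with $$O\biggl((q-1)n^3+n^2\deg(\pi_A(\lambda))+n^2\sum_{j=1}^n\deg\pi'_{A,j}(\lambda)+n^2\sum_{j=1}^{n}\sum_{k=1}^{q''_j}d_k\{(m_k-\rho_{k,j})+k\delta_{k,j}\}\biggr)$$ arithmetic operations in $\mathbb{K}$.
   Context: Setting. $f_1,\ldots,f_q$ are the pairwise distinct monic irreducible factors of $\chi_A$ over $\mathbb{K}$, $m_p\ge1$, $d_p=\deg f_p$, $g_p(\lambda)=\chi_A(\lambda)/f_p(\lambda)^{m_p}$. $\pi_A$ is the minimal polynomial of $A$. The $j$-th unit minimal annihilating polynomial $\pi_{A,j}$ is the monic generator of the ideal $\{p\in\mathbb{K}[\lambda]\mid p(A)\bm{e}_j=\bm{0}\}$, with $\bm{e}_j$ the $j$-th unit column vector; write $\pi_{A,j}=\prod_{i=1}^q f_i^{r_{i,j}}$ with $0\le r_{i,j}\le m_i$. Cost model. Time is counted in arithmetic operations in $\mathbb{K}$; the factorization of $\chi_A$ is assumed given. A product $f(A)\bm{v}$ (or $\bm{w}f(A)$) with $\deg f=d$ is computed by Horner's rule with matrix-vector products, at cost $O(n^2d)$. Algorithm P (unit pseudo annihilating polynomials).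 Generate a random (nonzero) row vector $\bm{u}\in\mathbb{K}^n$. For $i=1,\ldots,q$: compute $g_i=\chi_A/f_i^{m_i}$ and $\bar{\bm{b}}=\bm{u}g_i(A)$ by Horner's rule; then for $k=0,1,\ldots,m_i-1$, for every $j$ whose exponent $\rho_{i,j}$ has not yet been set and for which the $j$-th entry of $\bar{\bm{b}}$ is $0$, set $\rho_{i,j}=k$, and then replace $\bar{\bm{b}}$ by $\bar{\bm{b}}f_i(A)$ (this loop is left as soon as, at the start of a pass, $\bar{\bm{b}}=\bm{0}$ and all $\rho_{i,j}$, $1\le j\le n$, are set); finally set every still unset $\rho_{i,j}$ to $m_i$. Output $(\rho_{i,j})$. The polynomial $\pi'_{A,j}=\prod_{i=1}^q f_i^{\rho_{i,j}}$ is called a $j$-th unit pseudo annihilating polynomial; it divides $\pi_{A,j}$. Algorithm M (unit minimal annihilating polynomials). Compute $(\rho_{i,j})$ by Algorithm P and set $r_{i,j}\leftarrow\rho_{i,j}$ for all $i,j$. For each $j=1,\ldots,n$: (1) Compute $\bm{v}\leftarrow\pi'_{A,j}(A)\bm{e}_j$. If $\bm{v}=\bm{0}$, go to the next $j$. Otherwise set $\bm{v}_0\leftarrow\bm{v}$. (2) For $i=1,2,\ldots,q$: for $l=1,\ldots,m_i-\rho_{i,j}$ replace $\bm{v}\leftarrow f_i(A)\bm{v}$, and if now $\bm{v}=\bm{0}$, set $r_{i,j}\leftarrow\rho_{i,j}+l$ and $\bm{v}_i\leftarrow\bm{0}$, replace $\bm{v}_k\leftarrow f_i(A)^l\bm{v}_k$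 for $k=i-1,\ldots,0$, and leave the loops over both $l$ and $i$, keeping the current value of $i$. If $\bm{v}\neq\bm{0}$ after the loop over $l$, set $\bm{v}_i\leftarrow\bm{v}$ and continue with the next $i$. (3) With $i$ the value at which step (2) stopped, for $k=i-1,\ldots,1$: set $\bm{v}\leftarrow\bm{v}_{k-1}$; for $l=0,1,\ldots,m_k-\rho_{k,j}-1$: if $\bm{v}=\bm{0}$, replace $\bm{v}_s\leftarrow f_k(A)^l\bm{v}_s$ for $s=k-2,\ldots,0$ and leave the loop over $l$; otherwise replace $\bm{v}\leftarrow f_k(A)\bm{v}$ and $r_{k,j}\leftarrow r_{k,j}+1$. Output $(r_{i,j})$. Quantities in the bound. $\rho_{i,j}$ and $\pi'_{A,j}$ are those produced by Algorithm P; $\delta_{i,j}=r_{i,j}-\rho_{i,j}$ (with $r_{i,j}$ the exponents in $\pi_{A,j}$), and $q''_j=\max\{1\le i\le q\mid\rho_{i,j}<r_{i,j}\}$, the inner sum being empty if no such $i$ exists.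
   Formalization: As described, Algorithm M can output wrong exponents: step (3) skips an update if v vanishes on the last pass over l. The bound is proved as stated; correct output is proved if no k with 2≤k<q''_j has ρ_{k,j}<r_{k,j}=m_k, and always, with the same bound, if l also runs to m_k−ρ_{k,j}. *)

theory Defs
  imports
    "Jordan_Normal_Form.Char_Poly"
    "HOL-Library.State_Monad"
begin

section \<open>Annihilating polynomials\<close>

definition poly_mat :: "'a::comm_ring_1 poly \<Rightarrow> 'a mat \<Rightarrow> 'a mat" where
  "poly_mat p A = mat (dim_row A) (dim_row A)
     (\<lambda>(i, j). \<Sum>k\<le>degree p. coeff p k * (A ^\<^sub>m k) $$ (i, j))"

definition min_polynomial :: "'a::field mat \<Rightarrow> 'a poly" where
  "min_polynomial A = (THE g. lead_coeff g = 1 \<and>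
     {p. poly_mat p A = 0\<^sub>m (dim_row A) (dim_row A)} = {p. g dvd p})"

text \<open>Columns are numbered from \<open>0\<close>, as in the matrix library: \<open>j\<close> ranges over \<open>j < n\<close>.\<close>

definition unit_min_annihilator :: "'a::field mat \<Rightarrow> nat \<Rightarrow> 'a poly" where
  "unit_min_annihilator A j = (THE g. lead_coeff g = 1 \<and>
     {p. poly_mat p A *\<^sub>v unit_vec (dim_row A) j = 0\<^sub>v (dim_row A)} = {p. g dvd p})"

text \<open>The factors \<open>f i\<close> and the multiplicities \<open>m i\<close> are numbered by \<open>1 \<le> i \<le> q\<close>.\<close>

definition irreducible_factorization ::
    "'a::field poly \<Rightarrow> nat \<Rightarrow> (nat \<Rightarrow> 'a poly) \<Rightarrow> (nat \<Rightarrow> nat) \<Rightarrow> bool" where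
  "irreducible_factorization p q f m \<longleftrightarrow>
     (\<forall>i\<in>{1..q}. irreducible (f i) \<and> lead_coeff (f i) = 1 \<and> 1 \<le> m i) \<and>
     inj_on f {1..q} \<and> p = (\<Prod>i=1..q. f i ^ m i)"

text \<open>
  The library's \<^const>\<open>multiplicity\<close> is not available for polynomials over an arbitrary \<^class>\<open>field\<close>.
\<close>

definition factor_exponent :: "'a::field poly \<Rightarrow> 'a poly \<Rightarrow> nat" where
  "factor_exponent g p = (GREATEST k. g ^ k dvd p)"

definition factor_product ::
    "nat \<Rightarrow> (nat \<Rightarrow> 'a::field poly) \<Rightarrow> (nat \<Rightarrow> nat \<Rightarrow> nat) \<Rightarrow> nat \<Rightarrow> 'a poly" where
  "factor_product q f e j = (\<Prod>i=1..q. f i ^ e i j)"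


section \<open>Counting arithmetic operations\<close>

text \<open>
  The state is the number of operations in the ground field executed so far. It is changed
  only by \<open>add_op\<close>, \<open>sub_op\<close> and \<open>mult_op\<close>; tests for zero, index arithmetic and copying
  are not operations in the field and are free.
\<close>

type_synonym 'b counted = "(nat, 'b) state"

abbreviation ret :: "'b \<Rightarrow> 'b counted" where
  "ret \<equiv> State_Monad.return"

definition one_op :: "'b \<Rightarrow> 'b counted" where
  "one_op x = State (\<lambda>c. (x, c + 1))"

definition add_op :: "'a::field \<Rightarrow> 'a \<Rightarrow> 'a counted" where
  "add_op x y = one_op (x + y)"

definition sub_op :: "'a::field \<Rightarrow> 'a \<Rightarrow> 'a counted" where
  "sub_op x y = one_op (x - y)"

definition mult_op :: "'a::field \<Rightarrow> 'a \<Rightarrow> 'a counted" where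
  "mult_op x y = one_op (x * y)"

definition result_of :: "'b counted \<Rightarrow> 'b" where
  "result_of M = fst (run_state M 0)"

definition op_count :: "'b counted \<Rightarrow> nat" where
  "op_count M = snd (run_state M 0)"

fun for_each :: "'c list \<Rightarrow> ('c \<Rightarrow> 'b \<Rightarrow> 'b counted) \<Rightarrow> 'b \<Rightarrow> 'b counted" where
  "for_each [] body s = ret s"
| "for_each (x # xs) body s = do { s' \<leftarrow> body x s; for_each xs body s' }"


subsection \<open>Polynomials: schoolbook multiplication, division by a monic polynomial\<close>

fun add_coeffs :: "'a::field list \<Rightarrow> 'a list \<Rightarrow> 'a list counted" where
  "add_coeffs (x # xs) (y # ys) =
     do { z \<leftarrow> add_op x y; zs \<leftarrow> add_coeffs xs ys; ret (z # zs) }"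
| "add_coeffs xs [] = ret xs"
| "add_coeffs [] ys = ret ys"

fun sub_coeffs :: "'a::field list \<Rightarrow> 'a list \<Rightarrow> 'a list counted" where
  "sub_coeffs (x # xs) (y # ys) =
     do { z \<leftarrow> sub_op x y; zs \<leftarrow> sub_coeffs xs ys; ret (z # zs) }"
| "sub_coeffs xs [] = ret xs"
| "sub_coeffs [] (y # ys) =
     do { z \<leftarrow> sub_op 0 y; zs \<leftarrow> sub_coeffs [] ys; ret (z # zs) }"

definition poly_add :: "'a::field poly \<Rightarrow> 'a poly \<Rightarrow> 'a poly counted" where
  "poly_add p q = do { cs \<leftarrow> add_coeffs (coeffs p) (coeffs q); ret (poly_of_list cs) }"

definition poly_sub :: "'a::field poly \<Rightarrow> 'a poly \<Rightarrow> 'a poly counted" where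
  "poly_sub p q = do { cs \<leftarrow> sub_coeffs (coeffs p) (coeffs q); ret (poly_of_list cs) }"

definition poly_scale :: "'a::field \<Rightarrow> 'a poly \<Rightarrow> 'a poly counted" where
  "poly_scale a p =
     do { cs \<leftarrow> State_Monad.traverse_list (mult_op a) (coeffs p); ret (poly_of_list cs) }"

definition poly_mult :: "'a::field poly \<Rightarrow> 'a poly \<Rightarrow> 'a poly counted" where
  "poly_mult p q = for_each (rev (coeffs p))
     (\<lambda>a s. do { t \<leftarrow> poly_scale a q; poly_add (pCons 0 s) t }) 0"

definition poly_mult_power :: "'a::field poly \<Rightarrow> nat \<Rightarrow> 'a poly \<Rightarrow> 'a poly counted" where
  "poly_mult_power f k p = for_each [0..<k] (\<lambda>_ s. poly_mult f s) p"

text \<open>Long division: the state is the pair of quotient and remainder.\<close>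

definition poly_div_monic :: "'a::field poly \<Rightarrow> 'a poly \<Rightarrow> 'a poly counted" where
  "poly_div_monic p g = do {
     (quo, rem) \<leftarrow> for_each (rev (coeffs p))
       (\<lambda>a (s, r). do {
          let r' = pCons a r;
          let b = coeff r' (degree g);
          t \<leftarrow> poly_scale b g;
          r'' \<leftarrow> poly_sub r' t;
          ret (pCons b s, r'') }) (0, 0);
     ret quo }"


subsection \<open>Vectors, and Horner's rule with matrix-vector products\<close>

definition dot :: "'a::field vec \<Rightarrow> 'a vec \<Rightarrow> 'a counted" where
  "dot v w = for_each [0..<dim_vec w]
     (\<lambda>i s. do { t \<leftarrow> mult_op (v $ i) (w $ i); add_op s t }) 0"

definition mat_vec :: "'a::field mat \<Rightarrow> 'a vec \<Rightarrow> 'a vec counted" where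
  "mat_vec A v = do {
     xs \<leftarrow> State_Monad.traverse_list (\<lambda>i. dot (row A i) v) [0..<dim_row A];
     ret (vec_of_list xs) }"

definition vec_scale :: "'a::field \<Rightarrow> 'a vec \<Rightarrow> 'a vec counted" where
  "vec_scale a v = do {
     xs \<leftarrow> State_Monad.traverse_list (mult_op a) (list_of_vec v);
     ret (vec_of_list xs) }"

definition vec_add :: "'a::field vec \<Rightarrow> 'a vec \<Rightarrow> 'a vec counted" where
  "vec_add v w = do {
     xs \<leftarrow> State_Monad.traverse_list (\<lambda>i. add_op (v $ i) (w $ i)) [0..<dim_vec v];
     ret (vec_of_list xs) }"

text \<open>\<open>horner f A v\<close> computes \<open>f(A) v\<close>, and \<open>horner_row f A w\<close> the row vector \<open>w f(A)\<close>.\<close>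

definition horner :: "'a::field poly \<Rightarrow> 'a mat \<Rightarrow> 'a vec \<Rightarrow> 'a vec counted" where
  "horner f A v = (case rev (coeffs f) of
       [] \<Rightarrow> ret (0\<^sub>v (dim_vec v))
     | a # as \<Rightarrow> do {
         w \<leftarrow> vec_scale a v;
         for_each as (\<lambda>b w. do { x \<leftarrow> mat_vec A w; y \<leftarrow> vec_scale b v; vec_add x y }) w })"

definition horner_row :: "'a::field poly \<Rightarrow> 'a mat \<Rightarrow> 'a vec \<Rightarrow> 'a vec counted" where
  "horner_row f A w = horner f (transpose_mat A) w"

definition horner_power :: "'a::field poly \<Rightarrow> nat \<Rightarrow> 'a mat \<Rightarrow> 'a vec \<Rightarrow> 'a vec counted" where
  "horner_power f l A v = for_each [0..<l] (\<lambda>_ w. horner f A w) v"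


section \<open>Unit pseudo annihilating polynomials\<close>

text \<open>
  \<open>\<sigma> j = None\<close> means that the exponent of the current factor for column \<open>j\<close> has not been set.
  The first argument lists the values of \<open>k\<close> still to be processed.
\<close>

fun pseudo_loop ::
    "nat list \<Rightarrow> 'a::field mat \<Rightarrow> 'a poly \<Rightarrow> 'a vec \<Rightarrow> (nat \<Rightarrow> nat option) \<Rightarrow>
     (nat \<Rightarrow> nat option) counted" where
  "pseudo_loop [] A g b \<sigma> = ret \<sigma>"
| "pseudo_loop (k # ks) A g b \<sigma> =
     (if b = 0\<^sub>v (dim_row A) \<and> (\<forall>j<dim_row A. \<sigma> j \<noteq> None) then ret \<sigma>
      else do {
        let \<sigma>' = (\<lambda>j. if j < dim_row A \<and> \<sigma> j = None \<and> b $ j = 0 then Some k else \<sigma> j);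
        b' \<leftarrow> horner_row g A b;
        pseudo_loop ks A g b' \<sigma>' })"

text \<open>
  The random row vector is the argument \<open>u\<close>. The output maps \<open>i\<close> and \<open>j\<close> to \<open>\<rho>\<^bsub>i,j\<^esub>\<close>.
\<close>

definition pseudo_annihilators ::
    "'a::field mat \<Rightarrow> nat \<Rightarrow> (nat \<Rightarrow> 'a poly) \<Rightarrow> (nat \<Rightarrow> nat) \<Rightarrow> 'a vec \<Rightarrow>
     (nat \<Rightarrow> nat \<Rightarrow> nat) counted" where
  "pseudo_annihilators A q f m u = for_each [1..<Suc q]
     (\<lambda>i \<rho>. do {
        h \<leftarrow> poly_mult_power (f i) (m i) 1;
        g \<leftarrow> poly_div_monic (char_poly A) h;
        b \<leftarrow> horner_row g A u;
        \<sigma> \<leftarrow> pseudo_loop [0..<m i] A (f i) b (\<lambda>_. None);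
        ret (\<rho>(i := (\<lambda>j. case \<sigma> j of None \<Rightarrow> m i | Some k \<Rightarrow> k))) })
     (\<lambda>_ _. 0)"


section \<open>Unit minimal annihilating polynomials\<close>

text \<open>
  Throughout, \<open>f\<close>, \<open>m\<close> are as above, \<open>\<rho>\<close> and \<open>r\<close> (functions of \<open>i\<close> alone) are the exponents
  of the column under consideration, and \<open>vs k\<close> is the stored vector \<open>v\<^sub>k\<close>.

  \<open>update_stored A g l ks vs\<close> replaces \<open>v\<^sub>k\<close> by \<open>g(A)\<^sup>l v\<^sub>k\<close> for \<open>k\<close> in \<open>ks\<close>.
\<close>

definition update_stored ::
    "'a::field mat \<Rightarrow> 'a poly \<Rightarrow> nat \<Rightarrow> nat list \<Rightarrow> (nat \<Rightarrow> 'a vec) \<Rightarrow> (nat \<Rightarrow> 'a vec) counted" where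
  "update_stored A g l ks vs = for_each ks
     (\<lambda>k vs. do { w \<leftarrow> horner_power g l A (vs k); ret (vs(k := w)) }) vs"

text \<open>Multiply \<open>v\<close> by \<open>g(A)\<close> until it vanishes; the second component is the \<open>l\<close> at which it does.\<close>

fun multiply_until_zero ::
    "nat list \<Rightarrow> 'a::field mat \<Rightarrow> 'a poly \<Rightarrow> 'a vec \<Rightarrow> ('a vec \<times> nat option) counted" where
  "multiply_until_zero [] A g v = ret (v, None)"
| "multiply_until_zero (l # ls) A g v = do {
     v' \<leftarrow> horner g A v;
     if v' = 0\<^sub>v (dim_row A) then ret (v', Some l) else multiply_until_zero ls A g v' }"

text \<open>
  Returns the index \<open>i\<close> of the factor at which the vector vanishes (the last one whose exponent
  changes), with the stored vectors and the exponents. By the Cayley-Hamilton theorem the vector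
  does vanish, so the case \<open>[]\<close> is never reached.
\<close>

fun find_last_factor ::
    "nat list \<Rightarrow> 'a::field mat \<Rightarrow> (nat \<Rightarrow> 'a poly) \<Rightarrow> (nat \<Rightarrow> nat) \<Rightarrow> (nat \<Rightarrow> nat) \<Rightarrow>
     'a vec \<Rightarrow> (nat \<Rightarrow> 'a vec) \<Rightarrow> (nat \<Rightarrow> nat) \<Rightarrow>
     (nat \<times> (nat \<Rightarrow> 'a vec) \<times> (nat \<Rightarrow> nat)) counted" where
  "find_last_factor [] A f m \<rho> v vs r = ret (0, vs, r)"
| "find_last_factor (i # is) A f m \<rho> v vs r = do {
     (v', stop) \<leftarrow> multiply_until_zero [1..<Suc (m i - \<rho> i)] A (f i) v;
     case stop of
       Some l \<Rightarrow> do {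
         vs' \<leftarrow> update_stored A (f i) l (rev [0..<i]) (vs(i := 0\<^sub>v (dim_row A)));
         ret (i, vs', r(i := \<rho> i + l)) }
     | None \<Rightarrow> find_last_factor is A f m \<rho> v' (vs(i := v')) r }"

text \<open>
  Determines the exponent of the \<open>k\<close>-th factor \<open>g\<close>. For \<open>k = 1\<close> the list \<open>rev [0..<k - 1]\<close>,
  that is \<open>k - 2, \<dots>, 0\<close>, is empty.
\<close>

fun exponent_loop ::
    "nat list \<Rightarrow> 'a::field mat \<Rightarrow> 'a poly \<Rightarrow> nat \<Rightarrow> 'a vec \<Rightarrow> (nat \<Rightarrow> 'a vec) \<Rightarrow> (nat \<Rightarrow> nat) \<Rightarrow>
     ((nat \<Rightarrow> 'a vec) \<times> (nat \<Rightarrow> nat)) counted" where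
  "exponent_loop [] A g k v vs r = ret (vs, r)"
| "exponent_loop (l # ls) A g k v vs r =
     (if v = 0\<^sub>v (dim_row A) then do {
        vs' \<leftarrow> update_stored A g l (rev [0..<k - 1]) vs;
        ret (vs', r) }
      else do {
        v' \<leftarrow> horner g A v;
        exponent_loop ls A g k v' vs (r(k := r k + 1)) })"

text \<open>
  \<open>extra\<close> is the number of additional passes of \<^const>\<open>exponent_loop\<close>. The algorithm in its
  original form has \<open>extra = 0\<close>: the loop runs over \<open>l = 0, \<dots>, m\<^sub>k - \<rho>\<^sub>k - 1\<close>. If \<open>v\<close> becomes
  zero only in the last of these passes, that is never noticed, \<open>v\<^sub>s\<close> is not updated for
  \<open>s \<le> k - 2\<close>, and the exponents found for smaller \<open>k\<close> may be too large. Example: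
  \<open>f\<^sub>i = x - i\<close>, \<open>m = (2, 1, 1)\<close>, \<open>\<rho> = (0, 0, 0)\<close> and a column with minimal annihilating
  polynomial \<open>(x - 1)(x - 2)(x - 3)\<close> give \<open>(2, 1, 1)\<close>. With \<open>extra = 1\<close> the loop also visits
  \<open>l = m\<^sub>k - \<rho>\<^sub>k\<close>, where \<open>v\<close> is zero, so that the update always takes place.
\<close>

definition find_exponents ::
    "nat \<Rightarrow> 'a::field mat \<Rightarrow> (nat \<Rightarrow> 'a poly) \<Rightarrow> (nat \<Rightarrow> nat) \<Rightarrow> (nat \<Rightarrow> nat) \<Rightarrow>
     nat \<Rightarrow> (nat \<Rightarrow> 'a vec) \<Rightarrow> (nat \<Rightarrow> nat) \<Rightarrow> (nat \<Rightarrow> nat) counted" where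
  "find_exponents extra A f m \<rho> i vs r = do {
     (vs', r') \<leftarrow> for_each (rev [1..<i])
       (\<lambda>k (vs, r). exponent_loop [0..<m k - \<rho> k + extra] A (f k) k (vs (k - 1)) vs r) (vs, r);
     ret r' }"

definition unit_exponents ::
    "nat \<Rightarrow> 'a::field mat \<Rightarrow> nat \<Rightarrow> (nat \<Rightarrow> 'a poly) \<Rightarrow> (nat \<Rightarrow> nat) \<Rightarrow> (nat \<Rightarrow> nat) \<Rightarrow> nat \<Rightarrow>
     (nat \<Rightarrow> nat) counted" where
  "unit_exponents extra A q f m \<rho> j = do {
     p \<leftarrow> for_each [1..<Suc q] (\<lambda>i s. poly_mult_power (f i) (\<rho> i) s) 1;
     v \<leftarrow> horner p A (unit_vec (dim_row A) j);
     if v = 0\<^sub>v (dim_row A) then ret \<rho>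
     else do {
       (i, vs, r) \<leftarrow> find_last_factor [1..<Suc q] A f m \<rho> v (\<lambda>_. v) \<rho>;
       find_exponents extra A f m \<rho> i vs r } }"

definition min_annihilators_gen ::
    "nat \<Rightarrow> 'a::field mat \<Rightarrow> nat \<Rightarrow> (nat \<Rightarrow> 'a poly) \<Rightarrow> (nat \<Rightarrow> nat) \<Rightarrow> 'a vec \<Rightarrow>
     (nat \<Rightarrow> nat \<Rightarrow> nat) counted" where
  "min_annihilators_gen extra A q f m u = do {
     \<rho> \<leftarrow> pseudo_annihilators A q f m u;
     for_each [0..<dim_row A]
       (\<lambda>j r. do {
          e \<leftarrow> unit_exponents extra A q f m (\<lambda>i. \<rho> i j) j;
          ret (\<lambda>i. (r i)(j := e i)) })
       \<rho> }"

abbreviation min_annihilators where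
  "min_annihilators \<equiv> min_annihilators_gen 0"

abbreviation min_annihilators_full where
  "min_annihilators_full \<equiv> min_annihilators_gen 1"

end

theory Submission
  imports Defs "HOL-Computational_Algebra.Polynomial_Factorial"
begin

text \<open>
  The vector \<open>(\<Prod>\<^sub>i f\<^sub>i\<^bsup>b i\<^esup>)(A) e\<^sub>j\<close> vanishes iff \<open>b i \<ge> r\<^bsub>i,j\<^esub>\<close> for all \<open>i\<close>, so the course of the
  algorithms is determined by exponents alone. Algorithm P yields \<open>\<rho>\<^bsub>i,j\<^esub> \<le> r\<^bsub>i,j\<^esub>\<close>; after one more
  pass than the exponent of \<open>f\<^sub>i\<close> in the minimal polynomial its loop is left. In Algorithm M, step (2)
  stops at the last \<open>i\<close> with \<open>\<rho>\<^bsub>i,j\<^esub> < r\<^bsub>i,j\<^esub>\<close>, and before the \<open>k\<close>-th factor is treated in step (3)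
  the vector \<open>v\<^sub>s\<close> has exponents \<open>m\<^sub>i\<close> for \<open>i \<le> s\<close>, \<open>\<rho>\<^bsub>i,j\<^esub>\<close> for \<open>s < i \<le> k\<close> and \<open>r\<^bsub>i,j\<^esub>\<close> for \<open>i > k\<close>;
  hence \<open>v\<^bsub>k-1\<^esub>\<close> vanishes after exactly \<open>r\<^bsub>k,j\<^esub> - \<rho>\<^bsub>k,j\<^esub>\<close> multiplications by \<open>f\<^sub>k(A)\<close>.
\<close>

section \<open>Polynomials in a matrix, the Cayley-Hamilton theorem\<close>

text \<open>The cost bound is claimed for every run, including runs of the original loop of step (3)
  that return wrong exponents. Results and operation counts are therefore derived together by one
  calculus (\<open>computes\<close>), and the invariant of step (3) has a second alternative
  describing the runs that have gone wrong. The other difficulty is that the bound has no separate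
  term of order n^2, although polynomial arithmetic and the initial scalings of Horner's rule cost
  that much. They are absorbed because the minimal polynomial has degree at least 1. All estimates
  are made over the natural numbers with explicit constants; the passage to real numbers comes last
  and rests on \<open>\<rho> \<le> r \<le> m\<close>.\<close>

lemma poly_mat_carrier [simp]: "A \<in> carrier_mat n n \<Longrightarrow> poly_mat p A \<in> carrier_mat n n"
  by (simp add: poly_mat_def)

lemma poly_mat_dim [simp]:
  "dim_row (poly_mat p A) = dim_row A" "dim_col (poly_mat p A) = dim_row A"
  by (simp_all add: poly_mat_def)

text \<open>The defining sum stops at the degree, which differs between p, q and p + q. Padding it
  with zero coefficients to a common length makes entrywise comparison possible.\<close>

lemma poly_mat_index:
  assumes "A \<in> carrier_mat n n" "i < n" "j < n" "degree p \<le> N"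
  shows "poly_mat p A $$ (i, j) = (\<Sum>k\<le>N. coeff p k * (A ^\<^sub>m k) $$ (i, j))"
proof -
  have "(\<Sum>k\<le>degree p. coeff p k * (A ^\<^sub>m k) $$ (i, j)) = (\<Sum>k\<le>N. coeff p k * (A ^\<^sub>m k) $$ (i, j))"
    using assms(4) by (intro sum.mono_neutral_left) (auto simp: coeff_eq_0 not_le)
  then show ?thesis using assms by (simp add: poly_mat_def)
qed

lemma poly_mat_add:
  assumes A: "A \<in> carrier_mat n n"
  shows "poly_mat (p + q) A = poly_mat p A + poly_mat q A"
proof (rule eq_matI)
  fix i j assume "i < dim_row (poly_mat p A + poly_mat q A)" "j < dim_col (poly_mat p A + poly_mat q A)"
  then have ij: "i < n" "j < n" using A by auto
  let ?N = "max (degree p) (degree q)"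
  have "degree (p + q) \<le> ?N" by (rule degree_add_le_max)
  then show "poly_mat (p + q) A $$ (i, j) = (poly_mat p A + poly_mat q A) $$ (i, j)"
    using poly_mat_index[OF A ij, of _ ?N] A ij by (simp add: distrib_right sum.distrib)
qed (use A in auto)

lemma poly_mat_smult:
  assumes A: "A \<in> carrier_mat n n"
  shows "poly_mat (Polynomial.smult c p) A = c \<cdot>\<^sub>m poly_mat p A"
proof (rule eq_matI)
  fix i j assume "i < dim_row (c \<cdot>\<^sub>m poly_mat p A)" "j < dim_col (c \<cdot>\<^sub>m poly_mat p A)"
  then have ij: "i < n" "j < n" using A by auto
  have "degree (Polynomial.smult c p) \<le> degree p" by (rule degree_smult_le)
  then show "poly_mat (Polynomial.smult c p) A $$ (i, j) = (c \<cdot>\<^sub>m poly_mat p A) $$ (i, j)"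
    using poly_mat_index[OF A ij, of _ "degree p"] A ij by (simp add: sum_distrib_left mult.assoc)
qed (use A in auto)

lemma poly_mat_0 [simp]: "A \<in> carrier_mat n n \<Longrightarrow> poly_mat 0 A = 0\<^sub>m n n"
  by (rule eq_matI) (auto simp: poly_mat_def)

lemma poly_mat_1 [simp]: "A \<in> carrier_mat n n \<Longrightarrow> poly_mat 1 A = 1\<^sub>m n"
  by (rule eq_matI) (auto simp: poly_mat_def)

lemma pow_mat_Suc_left:
  "A \<in> carrier_mat n n \<Longrightarrow> A ^\<^sub>m Suc k = A * A ^\<^sub>m k"
proof (induction k)
  case (Suc k)
  then show ?case by (metis assoc_mult_mat pow_carrier_mat pow_mat.simps(2))
qed auto

lemma poly_mat_pCons_0:
  assumes A: "A \<in> carrier_mat n n"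
  shows "poly_mat (pCons 0 p) A = A * poly_mat p A"
proof (rule eq_matI)
  fix i j assume "i < dim_row (A * poly_mat p A)" "j < dim_col (A * poly_mat p A)"
  then have ij: "i < n" "j < n" using A by auto
  have pow: "(A ^\<^sub>m Suc k) $$ (i, j) = (\<Sum>l<n. A $$ (i, l) * (A ^\<^sub>m k) $$ (l, j))" for k
    using A ij pow_carrier_mat[OF A, of k]
    by (simp only: pow_mat_Suc_left[OF A]) (simp add: scalar_prod_def atLeast0LessThan)
  have "degree (pCons 0 p) \<le> Suc (degree p)" by (rule degree_pCons_le)
  then have "poly_mat (pCons 0 p) A $$ (i, j)
      = (\<Sum>k\<le>Suc (degree p). coeff (pCons 0 p) k * (A ^\<^sub>m k) $$ (i, j))"
    by (rule poly_mat_index[OF A ij])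
  also have "\<dots> = (\<Sum>k\<le>degree p. coeff p k * (A ^\<^sub>m Suc k) $$ (i, j))"
    by (subst sum.atMost_Suc_shift) (simp del: pow_mat.simps)
  also have "\<dots> = (\<Sum>k\<le>degree p. \<Sum>l<n. A $$ (i, l) * (coeff p k * (A ^\<^sub>m k) $$ (l, j)))"
    by (simp only: pow) (simp add: sum_distrib_left algebra_simps)
  also have "\<dots> = (\<Sum>l<n. A $$ (i, l) * poly_mat p A $$ (l, j))"
    by (subst sum.swap) (use A ij in \<open>simp add: poly_mat_index[of A n _ _ p "degree p"] sum_distrib_left\<close>)
  also have "\<dots> = (A * poly_mat p A) $$ (i, j)"
    using A ij by (simp add: scalar_prod_def atLeast0LessThan)
  finally show "poly_mat (pCons 0 p) A $$ (i, j) = (A * poly_mat p A) $$ (i, j)" .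
qed (use A in auto)

text \<open>This is one step of Horner's rule. The inductions over polynomials below and the loop
  invariant of \<open>computes_horner\<close> rest on it.\<close>

lemma poly_mat_pCons:
  assumes A: "A \<in> carrier_mat n n"
  shows "poly_mat (pCons a p) A = a \<cdot>\<^sub>m 1\<^sub>m n + A * poly_mat p A"
proof -
  have "pCons a p = Polynomial.smult a 1 + pCons 0 p" by simp
  then show ?thesis
    using A by (simp only: poly_mat_add[OF A] poly_mat_smult[OF A] poly_mat_pCons_0[OF A]) simp
qed

lemma poly_mat_mult:
  assumes A: "A \<in> carrier_mat n n"
  shows "poly_mat (p * q) A = poly_mat p A * poly_mat q A"
proof (induction p)
  case 0
  then show ?case using A by simp
next
  case (pCons a p)
  let ?P = "poly_mat p A" let ?Q = "poly_mat q A"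
  have "poly_mat (pCons a p * q) A = a \<cdot>\<^sub>m ?Q + A * (?P * ?Q)"
    using pCons.IH by (simp add: poly_mat_add[OF A] poly_mat_smult[OF A] poly_mat_pCons_0[OF A])
  also have "\<dots> = (a \<cdot>\<^sub>m 1\<^sub>m n + A * ?P) * ?Q"
    using A by (simp add: add_mult_distrib_mat[of _ n n _ _ n] assoc_mult_mat[of _ n n _ n _ n]
        mult_smult_assoc_mat[of _ n n _ n])
  finally show ?case by (simp add: poly_mat_pCons[OF A])
qed

lemma poly_mat_mult_vec:
  assumes "A \<in> carrier_mat n n" "v \<in> carrier_vec n"
  shows "poly_mat (p * q) A *\<^sub>v v = poly_mat p A *\<^sub>v (poly_mat q A *\<^sub>v v)"
  using assms by (simp add: poly_mat_mult[OF assms(1)] assoc_mult_mat_vec[of _ n n _ n])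

lemma transpose_smult_mat: "transpose_mat (c \<cdot>\<^sub>m M) = c \<cdot>\<^sub>m transpose_mat M"
  by (rule eq_matI) auto

text \<open>Needed because \<open>horner_row\<close> treats a row vector as a column vector under
  the transposed matrix.\<close>

lemma poly_mat_transpose:
  assumes A: "A \<in> carrier_mat n n"
  shows "poly_mat p (transpose_mat A) = transpose_mat (poly_mat p A)"
proof (induction p)
  case 0
  then show ?case using A by simp
next
  case (pCons a p)
  have At: "transpose_mat A \<in> carrier_mat n n" using A by simp
  have X: "poly_mat (pCons 0 1) A = A" using A by (simp add: poly_mat_pCons_0)
  \<comment> \<open>X is split off on the right: transposition reverses the product, so the
    transposed A ends up on the left, as in \<open>poly_mat_pCons\<close>.\<close>
  have "pCons a p = [:a:] + p * pCons 0 1" by simp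
  then have "poly_mat (pCons a p) A = poly_mat [:a:] A + poly_mat p A * poly_mat (pCons 0 1) A"
    by (simp only: poly_mat_add[OF A] poly_mat_mult[OF A])
  also have "\<dots> = a \<cdot>\<^sub>m 1\<^sub>m n + poly_mat p A * A"
    unfolding X using A by (simp add: poly_mat_pCons[OF A])
  finally have "poly_mat (pCons a p) A = a \<cdot>\<^sub>m 1\<^sub>m n + poly_mat p A * A" .
  moreover have "transpose_mat (a \<cdot>\<^sub>m 1\<^sub>m n + poly_mat p A * A)
      = transpose_mat (a \<cdot>\<^sub>m 1\<^sub>m n) + transpose_mat (poly_mat p A * A)"
    by (rule transpose_add) (use A in auto)
  moreover have "transpose_mat (poly_mat p A * A) = transpose_mat A * transpose_mat (poly_mat p A)"
    by (rule transpose_mult) (use A in auto)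
  ultimately have "transpose_mat (poly_mat (pCons a p) A)
      = a \<cdot>\<^sub>m 1\<^sub>m n + transpose_mat A * transpose_mat (poly_mat p A)"
    by (simp add: transpose_smult_mat)
  then show ?case using pCons.IH by (simp add: poly_mat_pCons[OF At])
qed

lemma poly_mat_sum_index:
  assumes A: "A \<in> carrier_mat n n" and "i < n" "j < n"
  shows "poly_mat (\<Sum>x\<in>S. p x) A $$ (i, j) = (\<Sum>x\<in>S. poly_mat (p x) A $$ (i, j))"
proof (induction S rule: infinite_finite_induct)
  case (insert x S)
  then show ?case using assms by (simp add: poly_mat_add[OF A])
qed (use assms in auto)

text \<open>
  For \<open>B = X I - A\<close>, Bji below says \<open>\<Sum>\<^sub>j B\<^bsub>j,i\<^esub>(A) e\<^sub>j = 0\<close> for each \<open>i\<close>. Combining these relations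
  with the entries of the adjugate of \<open>B\<close> as coefficients gives \<open>det B (A) e\<^sub>k = 0\<close>.
\<close>

theorem cayley_hamilton:
  assumes A: "(A :: 'a::comm_ring_1 mat) \<in> carrier_mat n n"
  shows "poly_mat (char_poly A) A = 0\<^sub>m n n"
proof (rule eq_matI)
  fix t k assume "t < dim_row (0\<^sub>m n n :: 'a mat)" "k < dim_col (0\<^sub>m n n :: 'a mat)"
  then have tk: "t < n" "k < n" by auto
  let ?B = "char_poly_matrix A"
  have B: "?B \<in> carrier_mat n n" using A by simp
  note adj = adj_mat[OF B]
  have cp: "(\<Sum>i<n. ?B $$ (j, i) * adj_mat ?B $$ (i, k)) = (if j = k then char_poly A else 0)"
    if "j < n" for j
  proof -
    have "(?B * adj_mat ?B) $$ (j, k) = (det ?B \<cdot>\<^sub>m 1\<^sub>m n) $$ (j, k)" by (simp only: adj(2))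
    then show ?thesis using that tk B adj(1)
      by (auto simp: scalar_prod_def atLeast0LessThan char_poly_def)
  qed
  have Bji: "poly_mat (?B $$ (j, i)) A $$ (s, j)
      = (if j = i then A $$ (s, i) else 0) - (if j = s then A $$ (j, i) else 0)"
    if "j < n" "i < n" "s < n" for j i s
  proof -
    have e: "?B $$ (j, i) = pCons (- A $$ (j, i)) (if j = i then 1 else 0)"
      using A that by (auto simp: char_poly_matrix_def)
    show ?thesis unfolding e poly_mat_pCons[OF A] using A that by auto
  qed
  have "poly_mat (char_poly A) A $$ (t, k)
      = (\<Sum>j<n. poly_mat (if j = k then char_poly A else 0) A $$ (t, j))"
    using A tk by (subst sum.remove[of _ k]) auto
  \<comment> \<open>The factors from \<open>cp\<close> are commuted so that the entry of
    \<open>?B\<close> stands on the right and acts first on the j-th unit vector, where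
    \<open>Bji\<close> evaluates it.\<close>
  also have "\<dots> = (\<Sum>j<n. \<Sum>i<n. poly_mat (adj_mat ?B $$ (i, k) * ?B $$ (j, i)) A $$ (t, j))"
    using A tk by (intro sum.cong refl) (simp flip: cp add: poly_mat_sum_index[OF A] mult.commute)
  also have "\<dots> = (\<Sum>j<n. \<Sum>i<n. \<Sum>s<n. poly_mat (adj_mat ?B $$ (i, k)) A $$ (t, s) * poly_mat (?B $$ (j, i)) A $$ (s, j))"
    using A tk by (intro sum.cong refl)
      (simp add: poly_mat_mult[OF A] scalar_prod_def atLeast0LessThan)
  also have "\<dots> = (\<Sum>i<n. \<Sum>s<n. \<Sum>j<n. poly_mat (adj_mat ?B $$ (i, k)) A $$ (t, s) * poly_mat (?B $$ (j, i)) A $$ (s, j))"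
    by (subst sum.swap, rule sum.cong, rule refl, rule sum.swap)
  also have "\<dots> = (\<Sum>i<n. \<Sum>s<n. poly_mat (adj_mat ?B $$ (i, k)) A $$ (t, s) * (\<Sum>j<n. poly_mat (?B $$ (j, i)) A $$ (s, j)))"
    by (simp add: sum_distrib_left)
  \<comment> \<open>Summed over j, the two parts of \<open>Bji\<close> are both
    \<open>A $$ (s, i)\<close> and cancel.\<close>
  also have "\<dots> = 0"
    by (intro sum.neutral ballI) (simp add: Bji sum_subtractf)
  finally show "poly_mat (char_poly A) A $$ (t, k) = 0\<^sub>m n n $$ (t, k)" using tk by simp
qed (use A in auto)


section \<open>Products of powers of irreducible polynomials\<close>

lemma monic_irreducible_dvd_eq:
  fixes f g :: "'a::field poly"
  assumes "irreducible f" "lead_coeff f = 1" "irreducible g" "lead_coeff g = 1" "f dvd g"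
  shows "f = g"
proof -
  have "\<not> f dvd 1" using assms(1) by (auto simp: irreducible_def)
  then have "g dvd f" using assms(3,5) irreducibleD' by blast
  then show ?thesis using assms poly_dvd_antisym by metis
qed

text \<open>One copy of f is cancelled at a time: by primality it divides either g or the cofactor
  of g.\<close>

lemma dvd_prime_power_mult:
  fixes f :: "'a::field poly"
  assumes "prime_elem f" "g dvd f ^ m * P"
  shows "\<exists>k h. k \<le> m \<and> g = f ^ k * h \<and> h dvd P"
  using assms(2)
proof (induction m arbitrary: g)
  case 0
  then show ?case by (intro exI[of _ 0] exI[of _ g]) simp
next
  case (Suc m)
  have f0: "f \<noteq> 0" using assms(1) by auto
  show ?case
  proof (cases "f dvd g")
    case True
    then obtain g' where g': "g = f * g'" by (elim dvdE)
    with Suc.prems f0 have "g' dvd f ^ m * P" by (simp add: mult.assoc)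
    from Suc.IH[OF this] obtain k h where "k \<le> m" "g' = f ^ k * h" "h dvd P" by blast
    then show ?thesis using g' by (intro exI[of _ "Suc k"] exI[of _ h]) (simp add: mult.assoc)
  next
    case False
    from Suc.prems obtain y where y: "f ^ Suc m * P = g * y" by (elim dvdE)
    then have "f dvd g * y" by (metis dvd_mult2 dvd_triv_left power_Suc)
    with False assms(1) have "f dvd y" by (simp add: prime_elem_dvd_mult_iff)
    then obtain y' where "y = f * y'" by (elim dvdE)
    with y f0 have "f ^ m * P = g * y'" by (simp add: mult.assoc mult.left_commute)
    then have "g dvd f ^ m * P" by simp
    from Suc.IH[OF this] show ?thesis using le_Suc_eq by blast
  qed
qed

text \<open>Monicity fixes the unit, so that g equals the product of powers and is not merely
  associated with it.\<close>

lemma monic_dvd_prod_powers: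
  fixes f :: "'i \<Rightarrow> 'a::field poly"
  assumes "finite S" "\<And>i. i \<in> S \<Longrightarrow> irreducible (f i) \<and> lead_coeff (f i) = 1"
    "g dvd (\<Prod>i\<in>S. f i ^ m i)" "lead_coeff g = 1"
  shows "\<exists>e. (\<forall>i\<in>S. e i \<le> m i) \<and> g = (\<Prod>i\<in>S. f i ^ e i)"
  using assms
proof (induction S arbitrary: g rule: finite_induct)
  case empty
  then show ?case using poly_dvd_antisym[of g 1] by auto
next
  case (insert a S)
  have a: "prime_elem (f a)" "lead_coeff (f a) = 1"
    using insert.prems(1) field_poly_irreducible_imp_prime by auto
  have "g dvd f a ^ m a * (\<Prod>i\<in>S. f i ^ m i)"
    using insert.prems(2) insert.hyps by simp
  from dvd_prime_power_mult[OF a(1) this] obtain k h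
    where kh: "k \<le> m a" "g = f a ^ k * h" "h dvd (\<Prod>i\<in>S. f i ^ m i)" by blast
  have "lead_coeff h = 1" using insert.prems(3) kh(2) a(2) by (simp add: lead_coeff_mult lead_coeff_power)
  with insert.IH[of h] kh(3) insert.prems(1) obtain e
    where e: "\<forall>i\<in>S. e i \<le> m i" "h = (\<Prod>i\<in>S. f i ^ e i)" by auto
  have "(\<Prod>i\<in>S. f i ^ (e(a := k)) i) = h" unfolding e(2)
    using insert.hyps by (intro prod.cong) auto
  then show ?case using e kh insert.hyps
    by (intro exI[of _ "e(a := k)"]) (simp del: fun_upd_apply, simp)
qed

lemma prime_elem_dvd_prod:
  assumes "finite S" "prime_elem p" "p dvd (\<Prod>x\<in>S. g x)"
  shows "\<exists>x\<in>S. p dvd g x"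
  using assms(1,3)
proof (induction S rule: finite_induct)
  case (insert x S)
  then show ?case using assms(2) by (auto simp: prime_elem_dvd_mult_iff)
qed (use assms(2) in \<open>auto simp: prime_elem_def\<close>)

locale distinct_monic_irreducibles =
  fixes S :: "'i set" and f :: "'i \<Rightarrow> 'a::field poly"
  assumes fin: "finite S"
    and irred: "\<And>i. i \<in> S \<Longrightarrow> irreducible (f i)"
    and monic: "\<And>i. i \<in> S \<Longrightarrow> lead_coeff (f i) = 1"
    and inj: "inj_on f S"
begin

lemma prime: "i \<in> S \<Longrightarrow> prime_elem (f i)"
  using irred field_poly_irreducible_imp_prime by blast

text \<open>One factor \<open>f i\<close> too many would have to divide another \<open>f l\<close>;
  monic irreducible polynomials dividing each other are equal, against injectivity.\<close>

lemma power_dvd_prod_iff: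
  assumes "i \<in> S"
  shows "f i ^ k dvd (\<Prod>l\<in>S. f l ^ e l) \<longleftrightarrow> k \<le> e i"
proof
  let ?R = "\<Prod>l\<in>S - {i}. f l ^ e l"
  have split: "(\<Prod>l\<in>S. f l ^ e l) = f i ^ e i * ?R"
    using assms fin by (rule prod.remove[rotated])
  show "f i ^ k dvd (\<Prod>l\<in>S. f l ^ e l)" if "k \<le> e i"
    unfolding split using that by (simp add: le_imp_power_dvd)
  show "k \<le> e i" if dvd: "f i ^ k dvd (\<Prod>l\<in>S. f l ^ e l)"
  proof (rule ccontr)
    assume "\<not> k \<le> e i"
    then have "f i ^ Suc (e i) dvd f i ^ e i * ?R"
      using dvd unfolding split by (meson Suc_leI dvd_trans le_imp_power_dvd not_le)
    then have "f i dvd ?R" using prime[OF assms] by (auto simp: mult.commute)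
    then obtain l where l: "l \<in> S - {i}" "f i dvd f l ^ e l"
      using prime_elem_dvd_prod[of "S - {i}" "f i" "\<lambda>l. f l ^ e l"] prime[OF assms] fin by auto
    then have "f i dvd f l" using prime[OF assms] prime_elem_dvd_power by blast
    then have "f i = f l" using l assms irred monic by (intro monic_irreducible_dvd_eq) auto
    then show False using l assms inj by (auto simp: inj_on_def)
  qed
qed

lemma prod_dvd_prod_iff:
  "(\<Prod>l\<in>S. f l ^ e l) dvd (\<Prod>l\<in>S. f l ^ b l) \<longleftrightarrow> (\<forall>i\<in>S. e i \<le> b i)"
proof
  show "(\<Prod>l\<in>S. f l ^ e l) dvd (\<Prod>l\<in>S. f l ^ b l)" if "\<forall>i\<in>S. e i \<le> b i"
    using that by (intro prod_dvd_prod le_imp_power_dvd) auto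
  show "\<forall>i\<in>S. e i \<le> b i" if "(\<Prod>l\<in>S. f l ^ e l) dvd (\<Prod>l\<in>S. f l ^ b l)"
  proof
    fix i assume i: "i \<in> S"
    have "f i ^ e i dvd (\<Prod>l\<in>S. f l ^ e l)" using power_dvd_prod_iff[OF i] by blast
    then show "e i \<le> b i" using that power_dvd_prod_iff[OF i] dvd_trans by blast
  qed
qed

lemma factor_exponent_prod:
  assumes "i \<in> S"
  shows "factor_exponent (f i) (\<Prod>l\<in>S. f l ^ e l) = e i"
  unfolding factor_exponent_def power_dvd_prod_iff[OF assms] by (rule Greatest_equality) auto

end

text \<open>Justifies the definite descriptions \<open>min_polynomial\<close> and
  \<open>unit_min_annihilator\<close>: an element of least degree divides all others by division
  with remainder. The element \<open>p0\<close> excludes the zero ideal, which has no monic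
  generator; later the characteristic polynomial takes this place.\<close>

lemma ideal_monic_generator:
  fixes I :: "'a::field poly set"
  assumes add: "\<And>p q. p \<in> I \<Longrightarrow> q \<in> I \<Longrightarrow> p + q \<in> I"
    and mult: "\<And>p r. p \<in> I \<Longrightarrow> r * p \<in> I"
    and nz: "p0 \<in> I" "p0 \<noteq> 0"
  shows "\<exists>!g. lead_coeff g = 1 \<and> I = {p. g dvd p}"
proof (rule ex_ex1I)
  obtain p where p: "p \<in> I" "p \<noteq> 0" and least: "\<And>r. r \<in> I \<Longrightarrow> r \<noteq> 0 \<Longrightarrow> degree p \<le> degree r"
    using ex_has_least_nat[of "\<lambda>p. p \<in> I \<and> p \<noteq> 0" p0 degree] nz by auto
  let ?g = "Polynomial.smult (inverse (lead_coeff p)) p"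
  have gI: "?g \<in> I" using mult[OF p(1), of "[:inverse (lead_coeff p):]"] by simp
  have "p dvd r" if r: "r \<in> I" for r
  proof -
    have "r mod p = r + (- (r div p)) * p" by (simp add: minus_div_mult_eq_mod[symmetric])
    then have "r mod p \<in> I" using add[OF r mult[OF p(1)]] by metis
    then have "r mod p = 0" using least degree_mod_less'[OF p(2), of r] by (meson not_le)
    then show ?thesis by (simp add: dvd_eq_mod_eq_0)
  qed
  moreover have "r \<in> I" if "p dvd r" for r
    using that mult[OF p(1)] by (metis dvdE mult.commute)
  ultimately have "I = {r. ?g dvd r}" using p by (auto simp: smult_dvd_iff)
  then show "\<exists>g. lead_coeff g = 1 \<and> I = {p. g dvd p}" using p by (intro exI[of _ ?g]) simp
next
  fix g h :: "'a poly"
  assume "lead_coeff g = 1 \<and> I = {p. g dvd p}" "lead_coeff h = 1 \<and> I = {p. h dvd p}"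
  then show "g = h" by (metis dvd_refl mem_Collect_eq poly_dvd_antisym)
qed

lemma degree_prod_monic_powers:
  fixes f :: "'i \<Rightarrow> 'a::field poly"
  assumes "\<And>i. i \<in> S \<Longrightarrow> lead_coeff (f i) = 1"
  shows "degree (\<Prod>i\<in>S. f i ^ e i) = (\<Sum>i\<in>S. e i * degree (f i))"
    and "lead_coeff (\<Prod>i\<in>S. f i ^ e i) = 1"
proof -
  have "f i \<noteq> 0" if "i \<in> S" for i using assms[OF that] by auto
  then show "degree (\<Prod>i\<in>S. f i ^ e i) = (\<Sum>i\<in>S. e i * degree (f i))"
    by (subst degree_prod_sum_eq) (auto simp: degree_power_eq intro!: sum.cong)
  show "lead_coeff (\<Prod>i\<in>S. f i ^ e i) = 1"
    using assms by (simp add: lead_coeff_prod lead_coeff_power)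
qed


section \<open>Minimal annihilating polynomials\<close>

lemma annihilator_monic_generator:
  fixes A :: "'a::field mat"
  assumes A: "A \<in> carrier_mat n n" and B: "B \<in> carrier_mat n k"
  shows "\<exists>!g. lead_coeff g = 1 \<and> {p. poly_mat p A * B = 0\<^sub>m n k} = {p. g dvd p}"
proof (rule ideal_monic_generator)
  show "p + q \<in> {p. poly_mat p A * B = 0\<^sub>m n k}"
    if "p \<in> {p. poly_mat p A * B = 0\<^sub>m n k}" "q \<in> {p. poly_mat p A * B = 0\<^sub>m n k}" for p q
    using that A B by (simp add: poly_mat_add[OF A] add_mult_distrib_mat[of _ n n _ _ k])
  show "r * p \<in> {p. poly_mat p A * B = 0\<^sub>m n k}"
    if "p \<in> {p. poly_mat p A * B = 0\<^sub>m n k}" for p r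
    using that A B by (simp add: poly_mat_mult[OF A] assoc_mult_mat[of _ n n _ n _ k])
  show "char_poly A \<in> {p. poly_mat p A * B = 0\<^sub>m n k}"
    using cayley_hamilton[OF A] B by simp
  show "char_poly A \<noteq> 0" using degree_monic_char_poly[OF A] by auto
qed

lemma min_polynomial:
  fixes A :: "'a::field mat"
  assumes A: "A \<in> carrier_mat n n"
  shows "lead_coeff (min_polynomial A) = 1"
    and "poly_mat p A = 0\<^sub>m n n \<longleftrightarrow> min_polynomial A dvd p"
proof -
  have "\<exists>!g. lead_coeff g = 1 \<and> {p. poly_mat p A = 0\<^sub>m n n} = {p. g dvd p}"
    using annihilator_monic_generator[OF A one_carrier_mat] A by (simp add: right_mult_one_mat[of _ n n])
  from theI'[OF this] have "lead_coeff (min_polynomial A) = 1 \<and> {p. poly_mat p A = 0\<^sub>m n n} = {p. min_polynomial A dvd p}"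
    using A by (simp add: min_polynomial_def)
  then show "lead_coeff (min_polynomial A) = 1"
    and "poly_mat p A = 0\<^sub>m n n \<longleftrightarrow> min_polynomial A dvd p" by blast+
qed

lemma mult_mat_zero_vec: "M \<in> carrier_mat k n \<Longrightarrow> M *\<^sub>v 0\<^sub>v n = 0\<^sub>v k"
  by (rule eq_vecI) auto

lemma unit_min_annihilator:
  fixes A :: "'a::field mat"
  assumes A: "A \<in> carrier_mat n n"
  shows "lead_coeff (unit_min_annihilator A j) = 1"
    and "poly_mat p A *\<^sub>v unit_vec n j = 0\<^sub>v n \<longleftrightarrow> unit_min_annihilator A j dvd p"
proof -
  have "\<exists>!g. lead_coeff g = 1 \<and> {p. poly_mat p A *\<^sub>v unit_vec n j = 0\<^sub>v n} = {p. g dvd p}"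
  proof (rule ideal_monic_generator)
    show "p + q \<in> {p. poly_mat p A *\<^sub>v unit_vec n j = 0\<^sub>v n}"
      if "p \<in> {p. poly_mat p A *\<^sub>v unit_vec n j = 0\<^sub>v n}" "q \<in> {p. poly_mat p A *\<^sub>v unit_vec n j = 0\<^sub>v n}" for p q
      using that A by (simp add: poly_mat_add[OF A] add_mult_distrib_mat_vec[of _ n n])
    show "r * p \<in> {p. poly_mat p A *\<^sub>v unit_vec n j = 0\<^sub>v n}"
      if "p \<in> {p. poly_mat p A *\<^sub>v unit_vec n j = 0\<^sub>v n}" for p r
      using that A by (simp add: poly_mat_mult_vec[OF A] mult_mat_zero_vec[of _ n n])
    show "char_poly A \<in> {p. poly_mat p A *\<^sub>v unit_vec n j = 0\<^sub>v n}"
      using cayley_hamilton[OF A] by auto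
    show "char_poly A \<noteq> 0" using degree_monic_char_poly[OF A] by auto
  qed
  from theI'[OF this] have "lead_coeff (unit_min_annihilator A j) = 1 \<and>
      {p. poly_mat p A *\<^sub>v unit_vec n j = 0\<^sub>v n} = {p. unit_min_annihilator A j dvd p}"
    using A by (simp add: unit_min_annihilator_def)
  then show "lead_coeff (unit_min_annihilator A j) = 1"
    and "poly_mat p A *\<^sub>v unit_vec n j = 0\<^sub>v n \<longleftrightarrow> unit_min_annihilator A j dvd p" by blast+
qed

section \<open>Exponents of the irreducible factors in the annihilating polynomials\<close>

locale factored_matrix =
  fixes n :: nat and A :: "'a::field mat" and q :: nat and f :: "nat \<Rightarrow> 'a poly" and m :: "nat \<Rightarrow> nat"
  assumes A: "A \<in> carrier_mat n n"
    and fact: "irreducible_factorization (char_poly A) q f m"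
    and n_pos: "0 < n"
begin

sublocale distinct_monic_irreducibles "{1..q}" f
  using fact by unfold_locales (auto simp: irreducible_factorization_def)

lemma m_pos: "i \<in> {1..q} \<Longrightarrow> 1 \<le> m i"
  using fact by (auto simp: irreducible_factorization_def)

lemma char_poly_eq: "char_poly A = (\<Prod>i=1..q. f i ^ m i)"
  using fact by (auto simp: irreducible_factorization_def)

lemma degree_f_pos:
  assumes i: "i \<in> {1..q}"
  shows "1 \<le> degree (f i)"
proof (rule ccontr)
  assume "\<not> 1 \<le> degree (f i)"
  then have "f i = 1" using monic[OF i] monic_degree_0[of "f i"] by simp
  then show False using irred[OF i] by simp
qed

lemma sum_degrees: "(\<Sum>i=1..q. m i * degree (f i)) = n"
  using degree_prod_monic_powers(1)[of "{1..q}" f m] monic degree_monic_char_poly[OF A]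
  by (simp add: char_poly_eq)

lemma q_pos: "1 \<le> q"
  using sum_degrees n_pos by (cases q) auto

definition r :: "nat \<Rightarrow> nat \<Rightarrow> nat" where
  "r i j = factor_exponent (f i) (unit_min_annihilator A j)"

definition min_exp :: "nat \<Rightarrow> nat" where
  "min_exp i = factor_exponent (f i) (min_polynomial A)"

lemma monic_dvd_char_poly:
  assumes "g dvd char_poly A" "lead_coeff g = 1"
  shows "g = (\<Prod>i=1..q. f i ^ factor_exponent (f i) g)"
    and "\<forall>i\<in>{1..q}. factor_exponent (f i) g \<le> m i"
proof -
  obtain b where b: "\<forall>i\<in>{1..q}. b i \<le> m i" "g = (\<Prod>i=1..q. f i ^ b i)"
    using monic_dvd_prod_powers[of "{1..q}" f g m] assms irred monic char_poly_eq by auto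
  then have fe: "factor_exponent (f i) g = b i" if "i \<in> {1..q}" for i
    using factor_exponent_prod[OF that] by simp
  show "g = (\<Prod>i=1..q. f i ^ factor_exponent (f i) g)"
    by (subst b(2)) (intro prod.cong refl, simp add: fe)
  show "\<forall>i\<in>{1..q}. factor_exponent (f i) g \<le> m i" using b(1) fe by simp
qed

lemma unit_min_annihilator_eq: "unit_min_annihilator A j = factor_product q f r j"
  and r_le: "i \<in> {1..q} \<Longrightarrow> r i j \<le> m i"
proof -
  have "unit_min_annihilator A j dvd char_poly A"
    using unit_min_annihilator(2)[OF A, of "char_poly A" j] cayley_hamilton[OF A] by auto
  from monic_dvd_char_poly[OF this unit_min_annihilator(1)[OF A]]
  show "unit_min_annihilator A j = factor_product q f r j" "i \<in> {1..q} \<Longrightarrow> r i j \<le> m i"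
    by (simp_all add: factor_product_def r_def)
qed

lemma min_polynomial_eq: "min_polynomial A = (\<Prod>i=1..q. f i ^ min_exp i)"
  and min_exp_le: "i \<in> {1..q} \<Longrightarrow> min_exp i \<le> m i"
proof -
  have "min_polynomial A dvd char_poly A"
    using min_polynomial(2)[OF A, of "char_poly A"] cayley_hamilton[OF A] by auto
  from monic_dvd_char_poly[OF this min_polynomial(1)[OF A]]
  show "min_polynomial A = (\<Prod>i=1..q. f i ^ min_exp i)" "i \<in> {1..q} \<Longrightarrow> min_exp i \<le> m i"
    by (simp_all add: min_exp_def)
qed

lemma degree_min_polynomial: "degree (min_polynomial A) = (\<Sum>i=1..q. min_exp i * degree (f i))"
  unfolding min_polynomial_eq using monic by (intro degree_prod_monic_powers) auto

text \<open>A constant minimal polynomial would make the identity matrix zero. This lower bound is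
  what absorbs terms of order n^2 into \<open>n\<^sup>2 * degree (min_polynomial A)\<close>.\<close>

lemma degree_min_polynomial_pos: "1 \<le> degree (min_polynomial A)"
proof (rule ccontr)
  assume "\<not> 1 \<le> degree (min_polynomial A)"
  then have "min_polynomial A = 1"
    using min_polynomial(1)[OF A] by (metis One_nat_def Suc_leI monic_degree_0 neq0_conv)
  then have "poly_mat 1 A = 0\<^sub>m n n" using min_polynomial(2)[OF A, of 1] by simp
  then have "1\<^sub>m n $$ (0, 0) = (0\<^sub>m n n :: 'a mat) $$ (0, 0)" using A by simp
  then show False using n_pos by simp
qed

text \<open>
  Algorithm P may make one pass more for the \<open>i\<close>-th factor than its exponent in the minimal
  polynomial, which costs \<open>O(n\<^sup>2 \<Sum>d\<^sub>i)\<close> operations in total. For \<open>q \<ge> 2\<close> the term \<open>(q - 1)n\<^sup>3\<close>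
  absorbs this.
\<close>

lemma sum_degrees_le: "(\<Sum>i=1..q. degree (f i)) \<le> (q - 1) * n + degree (min_polynomial A)"
proof (cases "q = 1")
  case True
  have "min_exp 1 \<noteq> 0" using degree_min_polynomial_pos degree_min_polynomial True by auto
  then show ?thesis using True degree_min_polynomial by simp
next
  case False
  have "(\<Sum>i=1..q. degree (f i)) \<le> (\<Sum>i=1..q. m i * degree (f i))"
    using m_pos by (intro sum_mono) auto
  moreover have "1 * n \<le> (q - 1) * n" using False q_pos by (intro mult_right_mono) auto
  ultimately show ?thesis using sum_degrees by linarith
qed

text \<open>Every vector handled by Algorithm M while it treats column \<open>j\<close> is of the form \<open>w j b\<close>.\<close>

definition w :: "nat \<Rightarrow> (nat \<Rightarrow> nat) \<Rightarrow> 'a vec" where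
  "w j b = poly_mat (\<Prod>i=1..q. f i ^ b i) A *\<^sub>v unit_vec n j"

lemma w_carrier [simp]: "w j b \<in> carrier_vec n"
  unfolding w_def by (intro mult_mat_vec_carrier[of _ n n] poly_mat_carrier A unit_vec_carrier)

lemma w_eq_0_iff: "w j b = 0\<^sub>v n \<longleftrightarrow> (\<forall>i\<in>{1..q}. r i j \<le> b i)"
  unfolding w_def unit_min_annihilator(2)[OF A] unit_min_annihilator_eq factor_product_def
  by (rule prod_dvd_prod_iff)

lemma w_cong: "(\<And>i. i \<in> {1..q} \<Longrightarrow> b i = b' i) \<Longrightarrow> w j b = w j b'"
  unfolding w_def by (rule arg_cong[of _ _ "\<lambda>p. poly_mat p A *\<^sub>v unit_vec n j"]) (auto intro: prod.cong)

lemma poly_mat_w: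
  assumes "i \<in> {1..q}"
  shows "poly_mat (f i) A *\<^sub>v w j b = w j (b(i := Suc (b i)))"
proof -
  have "f i * (\<Prod>l=1..q. f l ^ b l) = (\<Prod>l=1..q. f l ^ (b(i := Suc (b i))) l)"
  proof -
    have "(\<Prod>l\<in>{1..q} - {i}. f l ^ (b(i := Suc (b i))) l) = (\<Prod>l\<in>{1..q} - {i}. f l ^ b l)"
      by (intro prod.cong) auto
    then show ?thesis
      using assms prod.remove[of "{1..q}" i "\<lambda>l. f l ^ b l"]
        prod.remove[of "{1..q}" i "\<lambda>l. f l ^ (b(i := Suc (b i))) l"] by (simp add: mult.assoc)
  qed
  then show ?thesis
    using A by (simp only: w_def flip: poly_mat_mult_vec[OF A unit_vec_carrier])
qed

end


section \<open>Operation counts of the basic routines\<close>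

text \<open>
  The number of operations must not depend on the initial value \<open>s\<close> of the counter; otherwise
  costs would not add up along \<open>\<bind>\<close>.
\<close>

definition computes :: "'b counted \<Rightarrow> ('b \<Rightarrow> bool) \<Rightarrow> nat \<Rightarrow> bool" where
  "computes M P k \<longleftrightarrow> (\<exists>x c. P x \<and> c \<le> k \<and> (\<forall>s. run_state M s = (x, s + c)))"

lemma computes_return: "P x \<Longrightarrow> computes (ret x) P k"
  by (force simp: computes_def)

lemma computes_one_op: "P x \<Longrightarrow> 1 \<le> k \<Longrightarrow> computes (one_op x) P k"
  by (force simp: computes_def one_op_def)

lemma computes_mono:
  "computes M P k \<Longrightarrow> (\<And>x. P x \<Longrightarrow> Q x) \<Longrightarrow> k \<le> l \<Longrightarrow> computes M Q l"
  unfolding computes_def by (meson le_trans)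

lemma computes_bind:
  assumes "computes M P a" "\<And>x. P x \<Longrightarrow> computes (F x) Q b"
  shows "computes (M \<bind> F) Q (a + b)"
proof -
  obtain x c where 1: "P x" "c \<le> a" "\<And>s. run_state M s = (x, s + c)"
    using assms(1) by (auto simp: computes_def)
  obtain y d where 2: "Q y" "d \<le> b" "\<And>s. run_state (F x) s = (y, s + d)"
    using assms(2)[OF 1(1)] by (auto simp: computes_def)
  have "\<forall>s. run_state (M \<bind> F) s = (y, s + (c + d))" using 1 2 by (simp add: add.assoc)
  then show ?thesis using 1 2 unfolding computes_def by (intro exI[of _ y] exI[of _ "c + d"]) simp
qed

lemma computes_bind_le:
  assumes "computes M P a" "\<And>x. P x \<Longrightarrow> computes (F x) Q b" "a + b \<le> k"
  shows "computes (M \<bind> F) Q k"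
  by (rule computes_mono[OF computes_bind[OF assms(1,2)] _ assms(3)])

lemma computes_result: "computes M P k \<Longrightarrow> P (result_of M)"
  by (auto simp: computes_def result_of_def)

lemma computes_op_count: "computes M P k \<Longrightarrow> op_count M \<le> k"
  by (auto simp: computes_def op_count_def)

text \<open>Identifies the exponents handed from Algorithm P to Algorithm M with the value
  \<open>result_of\<close> by which the final bound refers to them.\<close>

lemma computes_eq_result: "computes M P k \<Longrightarrow> computes M (\<lambda>x. x = result_of M) k"
  by (auto simp: computes_def result_of_def)

text \<open>The invariant is indexed by the number of completed passes, and the price may vary from
  pass to pass, as it does in loops over the factors.\<close>

lemma computes_for_each:
  assumes "I 0 s"
    and "\<And>t s. t < length xs \<Longrightarrow> I t s \<Longrightarrow> computes (body (xs ! t) s) (I (Suc t)) (c t)"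
  shows "computes (for_each xs body s) (I (length xs)) (\<Sum>t<length xs. c t)"
  using assms
proof (induction xs arbitrary: I c s)
  case (Cons x xs)
  have "computes (body x s) (I (Suc 0)) (c 0)" using Cons.prems(2)[of 0 s] Cons.prems(1) by simp
  moreover have "computes (for_each xs body s') (I (Suc (length xs))) (\<Sum>t<length xs. c (Suc t))"
    if "I (Suc 0) s'" for s'
    using Cons.IH[of "\<lambda>t. I (Suc t)" s' "\<lambda>t. c (Suc t)"] that Cons.prems(2)[of "Suc _"] by simp
  ultimately show ?case
    by (simp add: sum.lessThan_Suc_shift computes_bind del: sum.lessThan_Suc)
qed (simp add: computes_return)

lemma computes_for_each_fold:
  assumes "\<And>x s. x \<in> set xs \<Longrightarrow> computes (body x s) (\<lambda>y. y = g x s) c"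
  shows "computes (for_each xs body s) (\<lambda>y. y = fold g xs s) (length xs * c)"
  using assms
proof (induction xs arbitrary: s)
  case (Cons x xs)
  show ?case unfolding for_each.simps using Cons
    by (intro computes_bind_le[of _ "\<lambda>y. y = g x s" c _ _ "length xs * c"]) auto
qed (simp add: computes_return)

lemma computes_traverse_list:
  assumes "\<And>x. x \<in> set xs \<Longrightarrow> computes (F x) (\<lambda>y. y = g x) c"
  shows "computes (State_Monad.traverse_list F xs) (\<lambda>ys. ys = map g xs) (length xs * c)"
  using assms
proof (induction xs)
  case (Cons x xs)
  have "computes (F x) (\<lambda>y. y = g x) c"
    "computes (State_Monad.traverse_list F xs) (\<lambda>ys. ys = map g xs) (length xs * c)"
    using Cons by auto
  then show ?case unfolding State_Monad.traverse_list.simps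
    by (intro computes_bind_le[of _ "\<lambda>y. y = g x" c _ _ "length xs * c"]
        computes_bind_le[of _ "\<lambda>ys. ys = map g xs" _ _ _ 0] computes_return) auto
qed (simp add: computes_return)


section \<open>Polynomial arithmetic\<close>

lemma length_coeffs_le: "length (coeffs p) \<le> degree p + 1"
  by (cases "p = 0") (auto simp: length_coeffs_degree)

text \<open>Only the second list is charged: in \<open>poly_mult\<close> the first operand is the
  growing accumulator, whose length must not enter the cost. The equation is stated under
  \<open>Poly\<close> because cancellation can leave trailing zeros.\<close>

lemma computes_add_coeffs:
  "computes (add_coeffs xs ys) (\<lambda>zs. Poly zs = Poly xs + Poly ys) (length ys)"
proof (induction xs ys rule: add_coeffs.induct)
  case (1 x xs y ys)
  show ?case unfolding add_coeffs.simps add_op_def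
    by (intro computes_bind_le[of _ "\<lambda>z. z = x + y" 1 _ _ "length ys"] computes_one_op
        computes_bind_le[OF 1, where b = 0] computes_return) auto
qed (simp_all add: computes_return)

lemma computes_sub_coeffs:
  "computes (sub_coeffs xs ys) (\<lambda>zs. Poly zs = Poly xs - Poly ys) (length ys)"
proof (induction xs ys rule: sub_coeffs.induct)
  case (1 x xs y ys)
  show ?case unfolding sub_coeffs.simps sub_op_def
    by (intro computes_bind_le[of _ "\<lambda>z. z = x - y" 1 _ _ "length ys"] computes_one_op
        computes_bind_le[OF 1, where b = 0] computes_return) auto
next
  case (3 y ys)
  show ?case unfolding sub_coeffs.simps sub_op_def
    by (intro computes_bind_le[of _ "\<lambda>z. z = 0 - y" 1 _ _ "length ys"] computes_one_op
        computes_bind_le[OF 3, where b = 0] computes_return) auto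
qed (simp_all add: computes_return)

lemma computes_poly_add:
  fixes p r :: "'a::field poly"
  assumes "degree r \<le> D"
  shows "computes (poly_add p r) (\<lambda>s. s = p + r) (D + 1)"
  unfolding poly_add_def using assms length_coeffs_le[of r]
  by (intro computes_bind_le[OF computes_add_coeffs, where b = 0] computes_return) auto

lemma computes_poly_sub:
  fixes p r :: "'a::field poly"
  assumes "degree r \<le> D"
  shows "computes (poly_sub p r) (\<lambda>s. s = p - r) (D + 1)"
  unfolding poly_sub_def using assms length_coeffs_le[of r]
  by (intro computes_bind_le[OF computes_sub_coeffs, where b = 0] computes_return) auto

lemma Poly_map_mult: "Poly (map ((*) a) xs) = Polynomial.smult a (Poly xs)"
  by (induction xs) auto

lemma computes_poly_scale:
  assumes "degree p \<le> D"
  shows "computes (poly_scale a p) (\<lambda>s. s = Polynomial.smult a p) (D + 1)"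
proof -
  have "computes (State_Monad.traverse_list (mult_op a) (coeffs p))
      (\<lambda>ys. ys = map ((*) a) (coeffs p)) (length (coeffs p) * 1)"
    by (rule computes_traverse_list) (simp add: mult_op_def computes_one_op)
  then show ?thesis unfolding poly_scale_def using assms length_coeffs_le[of p]
    by (intro computes_bind_le[of _ "\<lambda>ys. ys = map ((*) a) (coeffs p)" "length (coeffs p)" _ _ 0]
        computes_return) (auto simp: Poly_map_mult)
qed

lemma computes_poly_mult:
  assumes "degree p \<le> E" "degree r \<le> D"
  shows "computes (poly_mult p r) (\<lambda>s. s = p * r) ((E + 1) * (2 * (D + 1)))"
proof -
  let ?g = "\<lambda>a s. pCons 0 s + Polynomial.smult a r"
  have "computes (poly_mult p r) (\<lambda>s. s = fold ?g (rev (coeffs p)) 0)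
      (length (rev (coeffs p)) * (2 * (D + 1)))"
    unfolding poly_mult_def
  proof (rule computes_for_each_fold)
    fix a s
    show "computes (poly_scale a r \<bind> poly_add (pCons 0 s)) (\<lambda>y. y = ?g a s) (2 * (D + 1))"
      using assms(2)
      by (intro computes_bind_le[OF computes_poly_scale] computes_mono[OF computes_poly_add]) auto
  qed
  moreover have "fold ?g (rev (coeffs p)) 0 = p * r"
    unfolding times_poly_def fold_coeffs_def by (simp add: foldr_conv_fold add.commute)
  moreover have "length (rev (coeffs p)) * (2 * (D + 1)) \<le> (E + 1) * (2 * (D + 1))"
    using length_coeffs_le[of p] assms(1) by (intro mult_right_mono) auto
  ultimately show ?thesis using computes_mono by fastforce
qed

text \<open>The intermediate degrees do not exceed the final one, so a single bound D prices every
  pass.\<close>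

lemma computes_poly_mult_power:
  assumes "g \<noteq> 0" "p \<noteq> 0" "degree (g ^ k * p) \<le> D"
  shows "computes (poly_mult_power g k p) (\<lambda>s. s = g ^ k * p)
    (k * ((degree g + 1) * (2 * (D + 1))))"
proof -
  have "computes (poly_mult_power g k p) (\<lambda>s. s = g ^ length [0..<k] * p)
      (\<Sum>t<length [0..<k]. (degree g + 1) * (2 * (D + 1)))"
    unfolding poly_mult_power_def
  proof (rule computes_for_each[where I = "\<lambda>t s. s = g ^ t * p"])
    fix t s assume t: "t < length [0..<k]" "s = g ^ t * p"
    have "degree (g ^ t * p) \<le> degree (g ^ k * p)"
      using assms(1,2) t by (simp add: degree_mult_eq degree_power_eq)
    then show "computes (poly_mult g s) (\<lambda>s. s = g ^ Suc t * p) ((degree g + 1) * (2 * (D + 1)))"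
      using computes_poly_mult[of g "degree g" s D] assms(3) t(2) by (simp add: mult.assoc)
  qed simp
  then show ?thesis by simp
qed

text \<open>Long division and Horner's rule both read the coefficients from the top; their
  invariants speak of the polynomial formed by the coefficients read so far.\<close>

lemma fold_pCons_coeffs: "fold pCons (rev (coeffs p)) 0 = p"
  by (induction p) (auto simp: cCons_def split: if_splits)

text \<open>Invariant: quotient times g plus remainder is the polynomial formed by the coefficients
  read so far, and the remainder has smaller degree than g. As g is monic, each quotient coefficient
  is read off without a division in the field.\<close>

lemma computes_poly_div_monic:
  assumes "lead_coeff g = 1" "1 \<le> degree g"
  shows "computes (poly_div_monic (h * g) g) (\<lambda>s. s = h)
    ((degree (h * g) + 1) * (2 * (degree g + 1)))"
proof -
  let ?cs = "rev (coeffs (h * g))" let ?c = "2 * (degree g + 1)"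
  let ?body = "\<lambda>a (s, r). do {
          let r' = pCons a r;
          let b = coeff r' (degree g);
          t \<leftarrow> poly_scale b g;
          r'' \<leftarrow> poly_sub r' t;
          ret (pCons b s, r'') }"
  let ?I = "\<lambda>t (s, r). s * g + r = fold pCons (take t ?cs) 0 \<and> degree r < degree g"
  have step: "computes (?body (?cs ! t) x) (?I (Suc t)) ?c" if t: "t < length ?cs" and I: "?I t x" for t x
  proof -
    obtain s r where x: "x = (s, r)" by fastforce
    define r' where "r' = pCons (?cs ! t) r"
    define b where "b = coeff r' (degree g)"
    have fold: "fold pCons (take (Suc t) ?cs) 0 = pCons (?cs ! t) (s * g + r)"
      using I t x by (simp add: take_Suc_conv_app_nth)
    have eq: "pCons b s * g + (r' - Polynomial.smult b g) = fold pCons (take (Suc t) ?cs) 0"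
      unfolding fold r'_def by (simp add: algebra_simps)
    have "degree r' \<le> degree g" using I x by (simp add: r'_def)
    moreover have "degree (Polynomial.smult b g) \<le> degree g" by (rule degree_smult_le)
    ultimately have le: "degree (r' - Polynomial.smult b g) \<le> degree g" by (rule degree_diff_le)
    \<comment> \<open>The top coefficient cancels, so the degree drops. If the difference is zero,
      its degree is 0, which is below \<open>degree g\<close> since g is not constant.\<close>
    have "coeff (r' - Polynomial.smult b g) (degree g) = 0" using assms(1) by (simp add: b_def)
    then have "r' - Polynomial.smult b g = 0 \<or> degree (r' - Polynomial.smult b g) \<noteq> degree g"
      using leading_coeff_0_iff[of "r' - Polynomial.smult b g"] by auto
    then have "degree (r' - Polynomial.smult b g) < degree g" using le assms(2) by auto
    then have "?I (Suc t) (pCons b s, r' - Polynomial.smult b g)" using eq by simp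
    then show ?thesis
      unfolding x Let_def prod.case r'_def[symmetric] b_def[symmetric]
      by (intro computes_bind_le[OF computes_poly_scale[of g "degree g"], where b = "degree g + 1"]
          computes_bind_le[OF computes_poly_sub[of _ "degree g"], where b = 0] computes_return) auto
  qed
  have "?I 0 (0, 0)" using assms(2) by simp
  then have loop: "computes (for_each ?cs ?body (0, 0)) (?I (length ?cs)) (\<Sum>t<length ?cs. ?c)"
    by (rule computes_for_each) (rule step)
  have uniq: "s = h" if I: "?I (length ?cs) (s, r)" for s r
  proof -
    have "s * g + r = h * g" "degree r < degree g" using I fold_pCons_coeffs[of "h * g"] by auto
    then have r: "(h - s) * g = r" "degree r < degree g" by (auto simp: algebra_simps)
    have "h - s = 0"
    proof (rule ccontr)
      assume "h - s \<noteq> 0"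
      then have "degree ((h - s) * g) = degree (h - s) + degree g"
        using assms by (intro degree_mult_eq) auto
      with r show False by simp
    qed
    then show ?thesis by simp
  qed
  have "(\<Sum>t<length ?cs. ?c) \<le> (degree (h * g) + 1) * ?c"
    using length_coeffs_le[of "h * g"] by (simp del: mult_Suc mult_Suc_right)
  then show ?thesis unfolding poly_div_monic_def
    by (intro computes_bind_le[OF loop, where b = 0] computes_return)
      (auto split: prod.splits intro!: computes_return uniq)
qed

section \<open>Vector operations and Horner's rule\<close>

lemma computes_dot:
  assumes "v \<in> carrier_vec n" "w \<in> carrier_vec n"
  shows "computes (dot v w) (\<lambda>s. s = v \<bullet> w) (2 * n)"
proof -
  have "computes (dot v w) (\<lambda>s. s = (\<Sum>i<length [0..<dim_vec w]. v $ i * w $ i)) (\<Sum>t<length [0..<dim_vec w]. 2)"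
    unfolding dot_def
  proof (rule computes_for_each[where I = "\<lambda>t s. s = (\<Sum>i<t. v $ i * w $ i)"])
    fix t s assume "t < length [0..<dim_vec w]" "s = (\<Sum>i<t. v $ i * w $ i)"
    then show "computes (mult_op (v $ ([0..<dim_vec w] ! t)) (w $ ([0..<dim_vec w] ! t)) \<bind> add_op s)
        (\<lambda>s. s = (\<Sum>i<Suc t. v $ i * w $ i)) 2"
      unfolding mult_op_def add_op_def
      by (intro computes_bind_le[of _ "\<lambda>x. x = v $ t * w $ t" 1 _ _ 1] computes_one_op) auto
  qed simp
  then show ?thesis using assms by (simp add: scalar_prod_def atLeast0LessThan mult.commute)
qed

lemma computes_mat_vec:
  assumes "A \<in> carrier_mat n n" "v \<in> carrier_vec n"
  shows "computes (mat_vec A v) (\<lambda>w. w = A *\<^sub>v v) (2 * n\<^sup>2)"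
proof -
  have "computes (State_Monad.traverse_list (\<lambda>i. dot (row A i) v) [0..<dim_row A])
      (\<lambda>xs. xs = map (\<lambda>i. row A i \<bullet> v) [0..<dim_row A]) (length [0..<dim_row A] * (2 * n))"
    using assms by (intro computes_traverse_list computes_dot) auto
  then show ?thesis unfolding mat_vec_def using assms
    by (intro computes_bind_le[of _ "\<lambda>xs. xs = map (\<lambda>i. row A i \<bullet> v) [0..<dim_row A]" "2 * n\<^sup>2" _ _ 0] computes_return)
      (auto simp: power2_eq_square mult.left_commute vec_of_list_index)
qed

lemma computes_vec_scale:
  assumes "v \<in> carrier_vec n"
  shows "computes (vec_scale a v) (\<lambda>w. w = a \<cdot>\<^sub>v v) n"
proof -
  have "computes (State_Monad.traverse_list (mult_op a) (list_of_vec v))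
      (\<lambda>xs. xs = map ((*) a) (list_of_vec v)) (length (list_of_vec v) * 1)"
    by (rule computes_traverse_list) (simp add: mult_op_def computes_one_op)
  then show ?thesis unfolding vec_scale_def using assms
    by (intro computes_bind_le[of _ "\<lambda>xs. xs = map ((*) a) (list_of_vec v)" n _ _ 0] computes_return)
      (auto simp: vec_of_list_index list_of_vec_index)
qed

lemma computes_vec_add:
  assumes "v \<in> carrier_vec n" "w \<in> carrier_vec n"
  shows "computes (vec_add v w) (\<lambda>x. x = v + w) n"
proof -
  have "computes (State_Monad.traverse_list (\<lambda>i. add_op (v $ i) (w $ i)) [0..<dim_vec v])
      (\<lambda>xs. xs = map (\<lambda>i. v $ i + w $ i) [0..<dim_vec v]) (length [0..<dim_vec v] * 1)"
    by (rule computes_traverse_list) (simp add: add_op_def computes_one_op)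
  then show ?thesis unfolding vec_add_def using assms
    by (intro computes_bind_le[of _ "\<lambda>xs. xs = map (\<lambda>i. v $ i + w $ i) [0..<dim_vec v]" n _ _ 0] computes_return)
      (auto simp: vec_of_list_index)
qed

text \<open>The initial scaling by the leading coefficient costs n. Each of the d passes costs
  \<open>2 * n\<^sup>2\<close> for the matrix-vector product and n each for a scaling and an
  addition.\<close>

definition horner_cost :: "nat \<Rightarrow> nat \<Rightarrow> nat" where
  "horner_cost n d = n + d * (2 * n\<^sup>2 + 2 * n)"

lemma computes_horner:
  assumes A: "A \<in> carrier_mat n n" and v: "v \<in> carrier_vec n"
  shows "computes (horner g A v) (\<lambda>w. w = poly_mat g A *\<^sub>v v) (horner_cost n (degree g))"
proof (cases "rev (coeffs g)")
  case Nil
  then have "g = 0" by simp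
  moreover have "0\<^sub>m n n *\<^sub>v v = 0\<^sub>v n" by (rule eq_vecI) (use v in auto)
  ultimately show ?thesis using A v by (simp add: horner_def computes_return)
next
  case (Cons a as)
  let ?p = "\<lambda>t. fold pCons (take t as) [:a:]"
  let ?I = "\<lambda>t w. w = poly_mat (?p t) A *\<^sub>v v"
  have "g \<noteq> 0" using Cons by auto
  then have len: "length as = degree g" using Cons length_coeffs_degree[of g]
    by (metis Suc_inject length_Cons length_rev)
  have p: "?p (length as) = g"
    using fold_pCons_coeffs[of g] Cons by simp
  have body: "computes (do { x \<leftarrow> mat_vec A w; y \<leftarrow> vec_scale (as ! t) v; vec_add x y }) (?I (Suc t)) (2 * n\<^sup>2 + 2 * n)"
    if t: "t < length as" and w: "?I t w" for t w
  proof -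
    have wc: "w \<in> carrier_vec n" unfolding w
      by (intro mult_mat_vec_carrier[of _ n n] poly_mat_carrier A v)
    have eq: "poly_mat (?p (Suc t)) A *\<^sub>v v = A *\<^sub>v w + (as ! t) \<cdot>\<^sub>v v"
    proof -
      have "poly_mat (?p (Suc t)) A = (as ! t) \<cdot>\<^sub>m 1\<^sub>m n + A * poly_mat (?p t) A"
        using t by (simp add: take_Suc_conv_app_nth poly_mat_pCons[OF A])
      moreover have "((as ! t) \<cdot>\<^sub>m 1\<^sub>m n + A * poly_mat (?p t) A) *\<^sub>v v
          = ((as ! t) \<cdot>\<^sub>m 1\<^sub>m n) *\<^sub>v v + (A * poly_mat (?p t) A) *\<^sub>v v"
        by (rule add_mult_distrib_mat_vec[of _ n n]) (use A v in auto)
      moreover have "((as ! t) \<cdot>\<^sub>m 1\<^sub>m n) *\<^sub>v v = (as ! t) \<cdot>\<^sub>v v"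
        by (rule eq_vecI) (use v in \<open>auto simp: smult_scalar_prod_distrib[of _ n]\<close>)
      moreover have "(A * poly_mat (?p t) A) *\<^sub>v v = A *\<^sub>v w"
        unfolding w by (rule assoc_mult_mat_vec[of _ n n _ n]) (use A v in auto)
      moreover have "(as ! t) \<cdot>\<^sub>v v + A *\<^sub>v w = A *\<^sub>v w + (as ! t) \<cdot>\<^sub>v v"
        by (rule comm_add_vec[of _ n]) (use v mult_mat_vec_carrier[OF A wc] in auto)
      ultimately show ?thesis by simp
    qed
    show ?thesis unfolding eq
      by (intro computes_bind_le[OF computes_mat_vec[OF A wc], where b = "2 * n"]
          computes_bind_le[OF computes_vec_scale[OF v], where b = n]
          computes_mono[OF computes_vec_add[of _ n]] mult_mat_vec_carrier[OF A])
        (use v wc mult_mat_vec_carrier[OF A wc] in auto)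
  qed
  have init: "?I 0 (a \<cdot>\<^sub>v v)"
    by (rule eq_vecI) (use A v in \<open>auto simp: poly_mat_pCons[OF A] smult_scalar_prod_distrib[of _ n]\<close>)
  have "computes (for_each as (\<lambda>b w. do { x \<leftarrow> mat_vec A w; y \<leftarrow> vec_scale b v; vec_add x y }) (a \<cdot>\<^sub>v v))
      (?I (length as)) (\<Sum>t<length as. 2 * n\<^sup>2 + 2 * n)"
    using init by (rule computes_for_each) (rule body)
  then have "computes (for_each as (\<lambda>b w. do { x \<leftarrow> mat_vec A w; y \<leftarrow> vec_scale b v; vec_add x y }) (a \<cdot>\<^sub>v v))
      (\<lambda>w. w = poly_mat g A *\<^sub>v v) (degree g * (2 * n\<^sup>2 + 2 * n))"
    unfolding p by (simp add: len)
  then show ?thesis unfolding horner_def Cons list.case horner_cost_def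
    by (intro computes_bind_le[OF computes_vec_scale[OF v]]) auto
qed


section \<open>Unit pseudo annihilating polynomials\<close>

lemma horner_cost_le:
  assumes "1 \<le> n" "1 \<le> d"
  shows "horner_cost n d \<le> 5 * n\<^sup>2 * d"
proof -
  have "1 \<le> n * d" using mult_le_mono[OF assms] by simp
  then have "n \<le> n * n * d" using mult_le_mono2[of 1 "n * d" n] by (simp add: mult.assoc)
  moreover have "n * d \<le> n * n * d" using mult_le_mono1[of 1 n "n * d"] assms(1) by (simp add: mult.assoc)
  moreover have "horner_cost n d = n + 2 * (n * n * d) + 2 * (n * d)"
    by (simp add: horner_cost_def power2_eq_square algebra_simps)
  moreover have "5 * n\<^sup>2 * d = 5 * (n * n * d)" by (simp add: power2_eq_square)
  ultimately show ?thesis by linarith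
qed

text \<open>Admits degree 0, where the n operations of the initial scaling cannot be absorbed. This
  occurs for the cofactor when q = 1 and for a pseudo annihilating polynomial equal to 1.\<close>

lemma horner_cost_le':
  assumes "1 \<le> n"
  shows "horner_cost n d \<le> n + 4 * n\<^sup>2 * d"
proof -
  have "n * (d * 1) \<le> n * (d * n)" using assms by (intro mult_left_mono) auto
  then show ?thesis by (simp add: horner_cost_def power2_eq_square algebra_simps)
qed

lemma mult_mat_unit_vec:
  fixes M :: "'a::semiring_1 mat"
  shows "M \<in> carrier_mat k n \<Longrightarrow> j < n \<Longrightarrow> M *\<^sub>v unit_vec n j = col M j"
  by (rule eq_vecI) auto

text \<open>In pass E at the latest the vector is zero and every open exponent is set. The exit test
  stands at the start of a pass, so it may succeed only in the next one; hence \<open>E + 1\<close>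
  products and not E. Since entry j is zero at index \<open>r j\<close>, no exponent is set later
  than that.\<close>

lemma computes_pseudo_loop:
  assumes dim: "dim_row A = n"
    and step: "\<And>k. computes (horner_row g A (bs k)) (\<lambda>b. b = bs (Suc k)) H"
    and zero: "\<And>k. E \<le> k \<Longrightarrow> bs k = 0\<^sub>v n"
    and root: "\<And>j. j < n \<Longrightarrow> bs (r j) $ j = 0"
    and "k \<le> M"
    and "\<And>j. j < n \<Longrightarrow> case \<sigma> j of Some x \<Rightarrow> x \<le> r j | None \<Rightarrow> k \<le> r j"
    and "E < k \<Longrightarrow> \<forall>j<n. \<sigma> j \<noteq> None"
  shows "computes (pseudo_loop [k..<M] A g (bs k) \<sigma>)
    (\<lambda>\<sigma>. \<forall>j<n. case \<sigma> j of Some x \<Rightarrow> x \<le> r j | None \<Rightarrow> M \<le> r j) ((E + 1 - k) * H)"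
  using assms(5-)
proof (induction "M - k" arbitrary: k \<sigma>)
  case 0
  then show ?case by (auto intro: computes_return)
next
  case (Suc d)
  then have list: "[k..<M] = k # [Suc k..<M]" by (simp add: upt_conv_Cons)
  show ?case
  proof (cases "bs k = 0\<^sub>v n \<and> (\<forall>j<n. \<sigma> j \<noteq> None)")
    case True
    then have "\<forall>j<n. case \<sigma> j of Some x \<Rightarrow> x \<le> r j | None \<Rightarrow> M \<le> r j"
      using Suc.prems(2) by (fastforce split: option.splits)
    then show ?thesis using True unfolding list by (simp add: dim computes_return)
  next
    case False
    then have "k \<le> E" using zero Suc.prems(3) by fastforce
    define \<sigma>' where "\<sigma>' = (\<lambda>j. if j < n \<and> \<sigma> j = None \<and> bs k $ j = 0 then Some k else \<sigma> j)"
    have "case \<sigma>' j of Some x \<Rightarrow> x \<le> r j | None \<Rightarrow> Suc k \<le> r j" if j: "j < n" for j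
    proof (cases "\<sigma> j")
      case None
      then have "k \<le> r j" using Suc.prems(2)[OF j] by simp
      \<comment> \<open>At k = \<open>r j\<close> the entry is zero and the exponent gets set; one
        that stays open has k < \<open>r j\<close>.\<close>
      moreover have "bs k $ j \<noteq> 0 \<Longrightarrow> k \<noteq> r j" using root[OF j] by metis
      ultimately show ?thesis using None j by (auto simp: \<sigma>'_def)
    qed (use Suc.prems(2)[OF j] in \<open>auto simp: \<sigma>'_def\<close>)
    moreover have "\<forall>j<n. \<sigma>' j \<noteq> None" if "E < Suc k"
      using that \<open>k \<le> E\<close> zero[of k] by (auto simp: \<sigma>'_def)
    ultimately have "computes (pseudo_loop [Suc k..<M] A g (bs (Suc k)) \<sigma>')
        (\<lambda>\<sigma>. \<forall>j<n. case \<sigma> j of Some x \<Rightarrow> x \<le> r j | None \<Rightarrow> M \<le> r j) ((E + 1 - Suc k) * H)"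
      using Suc.hyps(2) by (intro Suc.hyps(1)) auto
    then have "computes (horner_row g A (bs k) \<bind> (\<lambda>b'. pseudo_loop [Suc k..<M] A g b' \<sigma>'))
        (\<lambda>\<sigma>. \<forall>j<n. case \<sigma> j of Some x \<Rightarrow> x \<le> r j | None \<Rightarrow> M \<le> r j) (H + (E + 1 - Suc k) * H)"
      by (intro computes_bind[OF step]) simp
    moreover have "H + (E + 1 - Suc k) * H = (E + 1 - k) * H"
      using \<open>k \<le> E\<close> by (simp add: Suc_diff_le)
    ultimately show ?thesis unfolding list pseudo_loop.simps using False
      by (auto simp: dim Let_def \<sigma>'_def)
  qed
qed

section \<open>Algorithm P for a factored characteristic polynomial\<close>

context factored_matrix
begin

lemma degree_power_f: "i \<in> {1..q} \<Longrightarrow> degree (f i ^ k) = k * degree (f i)"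
  using monic[of i] by (subst degree_power_eq) auto

lemma m_degree_le: "i \<in> {1..q} \<Longrightarrow> m i * degree (f i) \<le> n"
  unfolding sum_degrees[symmetric] by (rule member_le_sum) auto

text \<open>Here h is the cofactor of \<open>f i ^ m i\<close>, which already contains every other
  factor to its full multiplicity; only the exponent of \<open>f i\<close> in g has to be supplied.
  It is applied to the unit minimal annihilating polynomial (an entry becomes zero) and to the
  minimal polynomial (the whole vector becomes zero).\<close>

lemma char_poly_dvd_cofactor:
  assumes i: "i \<in> {1..q}" and h: "char_poly A = h * f i ^ m i"
    and g: "g = (\<Prod>l=1..q. f l ^ b l)" and b: "\<And>l. l \<in> {1..q} \<Longrightarrow> b l \<le> m l"
    and k: "b i \<le> k"
  shows "g dvd h * f i ^ k"
proof -
  let ?R = "\<Prod>l\<in>{1..q} - {i}. f l ^ m l"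
  have "char_poly A = f i ^ m i * ?R"
    unfolding char_poly_eq using i by (intro prod.remove) auto
  moreover have "f i \<noteq> 0" using irred[OF i] by auto
  ultimately have R: "h = ?R" using h by (simp add: mult.commute)
  have "g = f i ^ b i * (\<Prod>l\<in>{1..q} - {i}. f l ^ b l)"
    unfolding g using i by (intro prod.remove) auto
  also have "\<dots> dvd f i ^ k * ?R"
    using k b by (intro mult_dvd_mono le_imp_power_dvd prod_dvd_prod) auto
  finally show ?thesis by (simp add: R mult.commute)
qed

text \<open>The summands belong to forming \<open>f i ^ m i\<close>, dividing by it, applying the
  cofactor to u, and the loop over k.\<close>

definition pseudo_cost :: "nat \<Rightarrow> nat" where
  "pseudo_cost i = m i * ((degree (f i) + 1) * (2 * (n + 1)))
     + (n + 1) * (2 * (m i * degree (f i) + 1))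
     + horner_cost n (n - m i * degree (f i))
     + (min_exp i + 1) * horner_cost n (degree (f i))"

lemma computes_pseudo_annihilators:
  assumes u: "u \<in> carrier_vec n"
  shows "computes (pseudo_annihilators A q f m u)
    (\<lambda>\<rho>. \<forall>i\<in>{1..q}. \<forall>j<n. \<rho> i j \<le> r i j) (\<Sum>i=1..q. pseudo_cost i)"
proof -
  have At: "transpose_mat A \<in> carrier_mat n n" using A by simp
  let ?body = "\<lambda>i \<rho>. do {
        h \<leftarrow> poly_mult_power (f i) (m i) 1;
        g \<leftarrow> poly_div_monic (char_poly A) h;
        b \<leftarrow> horner_row g A u;
        \<sigma> \<leftarrow> pseudo_loop [0..<m i] A (f i) b (\<lambda>_. None);
        ret (\<rho>(i := (\<lambda>j. case \<sigma> j of None \<Rightarrow> m i | Some k \<Rightarrow> k))) }"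
  have step: "computes (?body i \<rho>) (\<lambda>\<rho>'. \<forall>l\<in>insert i I. \<forall>j<n. \<rho>' l j \<le> r l j) (pseudo_cost i)"
    if i: "i \<in> {1..q}" and \<rho>: "\<forall>l\<in>I. \<forall>j<n. \<rho> l j \<le> r l j" for i I \<rho>
  proof -
    have fi: "f i \<noteq> 0" using irred[OF i] by auto
    have "f i ^ m i dvd char_poly A"
      unfolding char_poly_eq power_dvd_prod_iff[OF i] by simp
    then obtain h where h: "char_poly A = h * f i ^ m i" by (metis dvdE mult.commute)
    have deg: "degree (char_poly A) = n" using degree_monic_char_poly[OF A] by simp
    have "h \<noteq> 0" using h degree_monic_char_poly[OF A] by auto
    then have deg_h: "degree h = n - m i * degree (f i)"
      using deg fi degree_power_f[OF i, of "m i"] unfolding h by (simp add: degree_mult_eq)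
    define bs where "bs k = poly_mat (h * f i ^ k) (transpose_mat A) *\<^sub>v u" for k
    have bs_carrier: "bs k \<in> carrier_vec n" for k
      unfolding bs_def by (intro mult_mat_vec_carrier[of _ n n] poly_mat_carrier At u)
    have P: "computes (poly_mult_power (f i) (m i) 1) (\<lambda>s. s = f i ^ m i)
        (m i * ((degree (f i) + 1) * (2 * (n + 1))))"
      using computes_poly_mult_power[of "f i" 1 "m i" n] fi degree_power_f[OF i] m_degree_le[OF i] by simp
    have "1 * 1 \<le> m i * degree (f i)"
      using m_pos[OF i] degree_f_pos[OF i] by (intro mult_le_mono) auto
    moreover have "lead_coeff (f i ^ m i) = 1" using monic[OF i] by (simp only: lead_coeff_power power_one)
    ultimately have D: "computes (poly_div_monic (char_poly A) (f i ^ m i)) (\<lambda>s. s = h)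
        ((n + 1) * (2 * (m i * degree (f i) + 1)))"
      using computes_poly_div_monic[of "f i ^ m i" h] deg degree_power_f[OF i] by (simp flip: h)
    have Hr: "computes (horner_row h A u) (\<lambda>b. b = bs 0) (horner_cost n (n - m i * degree (f i)))"
      using computes_horner[OF At u, of h] by (simp add: horner_row_def bs_def deg_h)
    have step: "computes (horner_row (f i) A (bs k)) (\<lambda>b. b = bs (Suc k)) (horner_cost n (degree (f i)))" for k
    proof -
      have "bs (Suc k) = poly_mat (f i * (h * f i ^ k)) (transpose_mat A) *\<^sub>v u"
        unfolding bs_def by (simp add: mult.left_commute)
      then have "bs (Suc k) = poly_mat (f i) (transpose_mat A) *\<^sub>v bs k"
        unfolding bs_def poly_mat_mult_vec[OF At u] by simp
      then show ?thesis using computes_horner[OF At bs_carrier, of "f i" k] by (simp add: horner_row_def)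
    qed
    \<comment> \<open>Entry j of the row vector u M is the product of u with column j of M, and that
      column is M applied to the j-th unit vector. It is zero here, whatever u is.\<close>
    have root: "bs (r i j) $ j = 0" if j: "j < n" for j
    proof -
      let ?M = "poly_mat (h * f i ^ r i j) A"
      have "unit_min_annihilator A j dvd h * f i ^ r i j"
        by (rule char_poly_dvd_cofactor[OF i h unit_min_annihilator_eq[unfolded factor_product_def]])
          (auto intro: r_le)
      then have "?M *\<^sub>v unit_vec n j = 0\<^sub>v n" using unit_min_annihilator(2)[OF A] by blast
      then have "col ?M j = 0\<^sub>v n" using mult_mat_unit_vec[of ?M n n j] A j by simp
      then show ?thesis unfolding bs_def poly_mat_transpose[OF A] using A j u by simp
    qed
    have zero: "bs k = 0\<^sub>v n" if "min_exp i \<le> k" for k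
    proof -
      have "min_polynomial A dvd h * f i ^ k"
        by (rule char_poly_dvd_cofactor[OF i h min_polynomial_eq _ that]) (auto intro: min_exp_le)
      then have "poly_mat (h * f i ^ k) A = 0\<^sub>m n n" using min_polynomial(2)[OF A] by blast
      then show ?thesis unfolding bs_def poly_mat_transpose[OF A] using u by (intro eq_vecI) auto
    qed
    have L: "computes (pseudo_loop [0..<m i] A (f i) (bs 0) (\<lambda>_. None))
        (\<lambda>\<sigma>. \<forall>j<n. case \<sigma> j of Some x \<Rightarrow> x \<le> r i j | None \<Rightarrow> m i \<le> r i j) ((min_exp i + 1 - 0) * horner_cost n (degree (f i)))"
      by (rule computes_pseudo_loop[of A n, OF _ step zero root]) (use A in auto)
    show ?thesis unfolding pseudo_cost_def add.assoc
      apply (rule computes_bind[OF P])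
      apply (simp only:)
      apply (rule computes_bind[OF D])
      apply (simp only:)
      apply (rule computes_bind[OF Hr])
      apply (simp only:)
      apply (rule computes_bind_le[OF L, where b = 0])
      using \<rho> by (auto intro!: computes_return split: option.splits)
  qed
  have "computes (pseudo_annihilators A q f m u)
      (\<lambda>\<rho>. \<forall>i\<in>{1..length [1..<Suc q]}. \<forall>j<n. \<rho> i j \<le> r i j) (\<Sum>t<length [1..<Suc q]. pseudo_cost (Suc t))"
    unfolding pseudo_annihilators_def
  proof (rule computes_for_each[where I = "\<lambda>t \<rho>. \<forall>i\<in>{1..t}. \<forall>j<n. \<rho> i j \<le> r i j"])
    fix t \<rho> assume t: "t < length [1..<Suc q]" and \<rho>: "\<forall>i\<in>{1..t}. \<forall>j<n. \<rho> i j \<le> r i j"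
    have tq: "t < q" using t by (simp add: length_upt del: upt_Suc)
    then have nth: "[1..<Suc q] ! t = Suc t" by (subst nth_upt) auto
    have "insert (Suc t) {1..t} = {1..Suc t}" by auto
    then show "computes (?body ([1..<Suc q] ! t) \<rho>) (\<lambda>\<rho>. \<forall>i\<in>{1..Suc t}. \<forall>j<n. \<rho> i j \<le> r i j) (pseudo_cost (Suc t))"
      using step[of "Suc t" "{1..t}" \<rho>] tq \<rho> unfolding nth by simp
  qed simp
  moreover have "(\<Sum>t<q. pseudo_cost (Suc t)) = (\<Sum>i=1..q. pseudo_cost i)"
    by (rule sum.reindex_bij_witness[of _ "\<lambda>i. i - 1" Suc]) auto
  ultimately show ?thesis by (simp del: upt_Suc)
qed

lemma q_le: "q \<le> n"
proof -
  have "(\<Sum>i=1..q. 1) \<le> (\<Sum>i=1..q. m i * degree (f i))"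
    using m_pos degree_f_pos by (intro sum_mono) (metis One_nat_def mult_le_mono nat_mult_1)
  then show ?thesis using sum_degrees by simp
qed

text \<open>The degrees of the cofactors add up to (q - 1) n, which gives 4 of the 9; the other 5
  come from the additional passes through \<open>sum_degrees_le\<close>. Polynomial arithmetic and
  scalings amount to 17 n^2, and the loops contribute 10 times n^2 times the degree of the minimal
  polynomial, together 27.\<close>

lemma sum_pseudo_cost_le:
  "(\<Sum>i=1..q. pseudo_cost i) \<le> 9 * ((q - 1) * n ^ 3) + 27 * (n\<^sup>2 * degree (min_polynomial A))"
proof -
  let ?d = "\<lambda>i. degree (f i)" let ?D = "degree (min_polynomial A)"
  have one: "pseudo_cost i \<le> 16 * n * (m i * ?d i) + n + 4 * n\<^sup>2 * (n - m i * ?d i)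
      + 5 * n\<^sup>2 * (min_exp i * ?d i + ?d i)" if i: "i \<in> {1..q}" for i
  proof -
    have n: "n + 1 \<le> 2 * n" using n_pos by simp
    have "m i * ((?d i + 1) * (2 * (n + 1))) \<le> m i * ((2 * ?d i) * (2 * (2 * n)))"
      using degree_f_pos[OF i] n by (intro mult_le_mono) auto
    moreover have "1 * 1 \<le> m i * ?d i"
      using m_pos[OF i] degree_f_pos[OF i] by (intro mult_le_mono) auto
    then have "(n + 1) * (2 * (m i * ?d i + 1)) \<le> (2 * n) * (2 * (2 * (m i * ?d i)))"
      using n by (intro mult_le_mono) auto
    moreover have "horner_cost n (n - m i * ?d i) \<le> n + 4 * n\<^sup>2 * (n - m i * ?d i)"
      using n_pos by (intro horner_cost_le') auto
    moreover have "(min_exp i + 1) * horner_cost n (?d i) \<le> (min_exp i + 1) * (5 * n\<^sup>2 * ?d i)"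
      using n_pos degree_f_pos[OF i] by (intro mult_le_mono horner_cost_le) auto
    ultimately show ?thesis unfolding pseudo_cost_def by (simp add: algebra_simps)
  qed
  have cof: "(\<Sum>i=1..q. n - m i * ?d i) = (q - 1) * n"
  proof -
    have "(\<Sum>i=1..q. n - m i * ?d i) + (\<Sum>i=1..q. m i * ?d i) = (\<Sum>i=1..q. n)"
      unfolding sum.distrib[symmetric] using m_degree_le by (intro sum.cong) auto
    then show ?thesis using q_pos sum_degrees by (simp add: diff_mult_distrib)
  qed
  have "(\<Sum>i=1..q. pseudo_cost i) \<le> (\<Sum>i=1..q. 16 * n * (m i * ?d i) + n
      + 4 * n\<^sup>2 * (n - m i * ?d i) + 5 * n\<^sup>2 * (min_exp i * ?d i + ?d i))"
    using one by (rule sum_mono)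
  also have "\<dots> = 16 * n * n + q * n + 4 * n\<^sup>2 * ((q - 1) * n) + 5 * n\<^sup>2 * (?D + (\<Sum>i=1..q. ?d i))"
    by (simp only: sum.distrib sum_distrib_left[symmetric] sum_degrees cof degree_min_polynomial) simp
  also have "\<dots> \<le> 16 * n * n + n * n + 4 * n\<^sup>2 * ((q - 1) * n) + 5 * n\<^sup>2 * (?D + ((q - 1) * n + ?D))"
    using sum_degrees_le q_le by (intro add_mono mult_le_mono order.refl)
  also have "\<dots> = 17 * n\<^sup>2 + 10 * (n\<^sup>2 * ?D) + 9 * ((q - 1) * n ^ 3)"
    by (simp add: power2_eq_square power3_eq_cube algebra_simps)
  also have "\<dots> \<le> 9 * ((q - 1) * n ^ 3) + 27 * (n\<^sup>2 * ?D)"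
    using mult_le_mono2[OF degree_min_polynomial_pos, of "n\<^sup>2"] by simp
  finally show ?thesis .
qed

end


section \<open>Unit minimal annihilating polynomials\<close>

text \<open>All that the treatment of a column takes from Algorithm P is \<open>\<rho>_le\<close>. A
  poor choice of u is felt only through smaller exponents \<open>\<rho>\<close>.\<close>

locale column = factored_matrix +
  fixes j :: nat and \<rho> :: "nat \<Rightarrow> nat"
  assumes \<rho>_le: "i \<in> {1..q} \<Longrightarrow> \<rho> i \<le> r i j"
begin

abbreviation "W \<equiv> w j"
abbreviation "hc i \<equiv> horner_cost n (degree (f i))"
abbreviation "\<delta> i \<equiv> r i j - \<rho> i"

lemma computes_horner_W:
  assumes "i \<in> {1..q}"
  shows "computes (horner (f i) A (W b)) (\<lambda>y. y = W (b(i := Suc (b i)))) (hc i)"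
  using computes_horner[OF A w_carrier, of "f i" j b] by (simp only: poly_mat_w[OF assms])

lemma computes_horner_power_W:
  assumes i: "i \<in> {1..q}"
  shows "computes (horner_power (f i) l A (W b)) (\<lambda>y. y = W (b(i := b i + l))) (l * hc i)"
proof -
  have "computes (horner_power (f i) l A (W b)) (\<lambda>y. y = W (b(i := b i + length [0..<l])))
      (\<Sum>t<length [0..<l]. hc i)"
    unfolding horner_power_def
  proof (rule computes_for_each[where I = "\<lambda>t y. y = W (b(i := b i + t))"])
    fix t v assume "v = W (b(i := b i + t))"
    then show "computes (horner (f i) A v) (\<lambda>y. y = W (b(i := b i + Suc t))) (hc i)"
      using computes_horner_W[OF i, of "b(i := b i + t)"] by simp
  qed simp
  then show ?thesis by simp
qed

lemma computes_update_stored: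
  assumes i: "i \<in> {1..q}" and "distinct ks" and vs: "\<And>s. s \<in> set ks \<Longrightarrow> vs s = W (bs s)"
  shows "computes (update_stored A (f i) l ks vs)
    (\<lambda>vs'. \<forall>s. vs' s = (if s \<in> set ks then W ((bs s)(i := bs s i + l)) else vs s))
    (length ks * (l * hc i))"
proof -
  let ?I = "\<lambda>t vs'. \<forall>s. vs' s = (if s \<in> set (take t ks) then W ((bs s)(i := bs s i + l)) else vs s)"
  have "computes (update_stored A (f i) l ks vs) (?I (length ks)) (\<Sum>t<length ks. l * hc i)"
    unfolding update_stored_def
  proof (rule computes_for_each[where I = ?I])
    fix t vs' assume t: "t < length ks" and I: "?I t vs'"
    let ?k = "ks ! t"
    have "?k \<notin> set (take t ks)" using t \<open>distinct ks\<close>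
      by (auto simp: in_set_conv_nth nth_eq_iff_index_eq)
    then have k: "vs' ?k = W (bs ?k)" using I vs t by simp
    have "?I (Suc t) (vs'(?k := W ((bs ?k)(i := bs ?k i + l))))"
      using I t by (auto simp: take_Suc_conv_app_nth)
    then show "computes (do { w \<leftarrow> horner_power (f i) l A (vs' ?k); ret (vs'(?k := w)) })
        (?I (Suc t)) (l * hc i)"
      unfolding k by (intro computes_bind_le[OF computes_horner_power_W[OF i], where b = 0])
        (auto intro: computes_return)
  qed simp
  then show ?thesis by simp
qed

text \<open>Stated for a products already made, so that the induction goes through;
  \<open>max a N\<close> covers the empty list, where a may exceed N. The vector is tested only
  after a product, so index a itself is not among the tested ones.\<close>

lemma computes_multiply_until_zero:
  assumes i: "i \<in> {1..q}"
  shows "computes (multiply_until_zero [Suc a..<Suc N] A (f i) (W (b(i := b i + a))))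
    (\<lambda>(v', stop). case stop of
        None \<Rightarrow> v' = W (b(i := b i + max a N)) \<and> (\<forall>l\<in>{a<..N}. W (b(i := b i + l)) \<noteq> 0\<^sub>v n)
      | Some l \<Rightarrow> a < l \<and> l \<le> N \<and> W (b(i := b i + l)) = 0\<^sub>v n
          \<and> (\<forall>l'\<in>{a<..<l}. W (b(i := b i + l')) \<noteq> 0\<^sub>v n))
    ((N - a) * hc i)"
proof (induction "N - a" arbitrary: a)
  case 0
  then show ?case by (auto intro!: computes_return simp: max_def simp del: fun_upd_apply simp flip: fun_upd_def)
next
  case (Suc d)
  then have list: "[Suc a..<Suc N] = Suc a # [Suc (Suc a)..<Suc N]" by (simp add: upt_conv_Cons del: upt_Suc)
  have H: "computes (horner (f i) A (W (b(i := b i + a)))) (\<lambda>y. y = W (b(i := b i + Suc a))) (hc i)"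
    using computes_horner_W[OF i, of "b(i := b i + a)"] by simp
  have cost: "hc i + (N - Suc a) * hc i = (N - a) * hc i"
    using Suc.hyps(2) by (simp add: Suc_diff_Suc flip: mult_Suc)
  have dim: "dim_row A = n" using A by simp
  show ?case
  proof (cases "W (b(i := b i + Suc a)) = 0\<^sub>v n")
    case True
    show ?thesis unfolding list multiply_until_zero.simps cost[symmetric] dim
      using True Suc.hyps(2) by (intro computes_bind[OF H]) (auto intro!: computes_return)
  next
    case False
    have sets: "{a<..N} = insert (Suc a) {Suc a<..N}" "max (Suc a) N = max a N"
      using Suc.hyps(2) by auto
    have sets': "{a<..<l} = insert (Suc a) {Suc a<..<l}" if "Suc a < l" for l using that by auto
    show ?thesis unfolding list multiply_until_zero.simps cost[symmetric] dim
    proof (rule computes_bind[OF H])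
      fix v assume v: "v = W (b(i := b i + Suc a))"
      show "computes (if v = 0\<^sub>v n then ret (v, Some (Suc a))
           else multiply_until_zero [Suc (Suc a)..<Suc N] A (f i) v)
        (\<lambda>(v', stop). case stop of
            None \<Rightarrow> v' = W (b(i := b i + max a N)) \<and> (\<forall>l\<in>{a<..N}. W (b(i := b i + l)) \<noteq> 0\<^sub>v n)
          | Some l \<Rightarrow> a < l \<and> l \<le> N \<and> W (b(i := b i + l)) = 0\<^sub>v n
              \<and> (\<forall>l'\<in>{a<..<l}. W (b(i := b i + l')) \<noteq> 0\<^sub>v n)) ((N - Suc a) * hc i)"
        unfolding v using False Suc.hyps(2)
        by (simp only: if_False)
          (rule computes_mono[OF Suc.hyps(1)[of "Suc a"]];
            use False in \<open>auto simp: sets sets' split: option.splits simp del: upt_Suc greaterThanAtMost_iff greaterThanLessThan_iff\<close>)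
    qed
  qed
qed

text \<open>The index q''_j of the bound; the value 0 means that \<open>\<rho>\<close> is already
  correct and makes the inner sum empty.\<close>

definition qlast :: nat where
  "qlast = Max (insert 0 {i \<in> {1..q}. \<rho> i < r i j})"

lemma qlast_le: "qlast \<le> q"
  unfolding qlast_def by (subst Max_le_iff) auto

lemma qlast_less:
  assumes x: "x \<in> {1..q}" "qlast < x"
  shows "r x j = \<rho> x"
proof -
  have "x \<le> qlast" if "\<rho> x < r x j"
    unfolding qlast_def by (rule Max_ge) (use x that in auto)
  then have "\<not> \<rho> x < r x j" using x by auto
  then show ?thesis using \<rho>_le[OF x(1)] by simp
qed

lemma qlast_prop: "qlast \<noteq> 0 \<Longrightarrow> \<rho> qlast < r qlast j"
  using Max_in[of "insert 0 {i \<in> {1..q}. \<rho> i < r i j}"] unfolding qlast_def by fastforce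

text \<open>
  The exponents of the stored vector \<open>v\<^sub>s\<close> when the factors above the \<open>k\<close>-th have been settled.
\<close>

definition stored :: "nat \<Rightarrow> nat \<Rightarrow> nat \<Rightarrow> nat" where
  "stored k s x = (if x \<le> s then m x else if k < x then r x j else \<rho> x)"

text \<open>With k = q no factor counts as settled, so \<open>stored q s\<close> describes v_s as
  step (2) first stores it. It vanishes as soon as no factor above s is deficient.\<close>

lemma W_stored_q_eq_0_iff:
  assumes "s \<le> q"
  shows "W (stored q s) = 0\<^sub>v n \<longleftrightarrow> qlast \<le> s"
proof
  assume "W (stored q s) = 0\<^sub>v n"
  then have le: "r x j \<le> stored q s x" if "x \<in> {1..q}" for x using that by (simp add: w_eq_0_iff)
  show "qlast \<le> s"
  proof (rule ccontr)
    assume "\<not> qlast \<le> s"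
    then show False using le[of qlast] qlast_prop qlast_le by (auto simp: stored_def split: if_splits)
  qed
next
  assume s: "qlast \<le> s"
  have "r x j \<le> stored q s x" if x: "x \<in> {1..q}" for x
    using r_le[OF x] qlast_less[OF x] s x by (auto simp: stored_def)
  then show "W (stored q s) = 0\<^sub>v n" by (simp add: w_eq_0_iff)
qed

text \<open>Invariant of step (3). Only the vectors with index below k are read from here on; those
  above may be out of date.\<close>

definition settled :: "nat \<Rightarrow> (nat \<Rightarrow> 'a vec) \<times> (nat \<Rightarrow> nat) \<Rightarrow> bool" where
  "settled k = (\<lambda>(vs, e). (\<forall>s<k. vs s = W (stored k s)) \<and>
     (\<forall>x\<in>{1..q}. e x = (if k < x then r x j else \<rho> x)))"

lemma computes_find_last_factor:
  assumes "1 \<le> i" "i \<le> qlast" "\<And>s. s < i \<Longrightarrow> vs s = W (stored q s)"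
  shows "computes (find_last_factor [i..<Suc q] A f m \<rho> (W (stored q (i - 1))) vs \<rho>)
    (\<lambda>(i', st). i' = qlast \<and> settled (qlast - 1) st)
    ((\<Sum>k=i..qlast. (m k - \<rho> k) * hc k) + qlast * (\<delta> qlast * hc qlast))"
  using assms
proof (induction "qlast - i" arbitrary: i vs rule: less_induct)
  case (less i vs)
  have i: "i \<in> {1..q}" using less.prems(1,2) qlast_le by auto
  have dim: "dim_row A = n" using A by simp
  let ?N = "m i - \<rho> i"
  define b where "b = stored q (i - 1)"
  define v where "v l = W (b(i := b i + l))" for l
  have bi: "b i = \<rho> i" using i by (auto simp: b_def stored_def)
  have \<rho>m: "\<rho> i \<le> m i" using \<rho>_le[OF i] r_le[OF i, of j] by simp
  have "v 0 \<noteq> 0\<^sub>v n"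
  proof -
    have "i - 1 \<le> q" "\<not> qlast \<le> i - 1" using i less.prems(1,2) by auto
    then show ?thesis using W_stored_q_eq_0_iff[of "i - 1"] by (simp add: v_def b_def)
  qed
  have zero_iff: "v l = 0\<^sub>v n \<longleftrightarrow> qlast = i \<and> r i j \<le> \<rho> i + l" if "l \<le> ?N" for l
  proof
    assume "v l = 0\<^sub>v n"
    then have le: "r x j \<le> (b(i := b i + l)) x" if "x \<in> {1..q}" for x
      using that by (simp add: v_def w_eq_0_iff)
    have "qlast = i"
    proof (rule ccontr)
      assume "qlast \<noteq> i"
      then have "r qlast j \<le> \<rho> qlast"
        using le[of qlast] less.prems(2) i qlast_le by (auto simp: b_def stored_def split: if_splits)
      then show False using qlast_prop less.prems(1,2) by simp
    qed
    then show "qlast = i \<and> r i j \<le> \<rho> i + l" using le[OF i] bi by simp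
  next
    assume a: "qlast = i \<and> r i j \<le> \<rho> i + l"
    have "r x j \<le> (b(i := b i + l)) x" if x: "x \<in> {1..q}" for x
      using r_le[OF x, of j] qlast_less[OF x] a bi by (auto simp: b_def stored_def)
    then show "v l = 0\<^sub>v n" by (simp add: v_def w_eq_0_iff)
  qed
  have v0: "W (stored q (i - 1)) = W (b(i := b i + 0))" by (simp add: b_def)
  have list: "[i..<Suc q] = i # [Suc i..<Suc q]" using i by (simp add: upt_conv_Cons del: upt_Suc)
  have one: "[1..<Suc ?N] = [Suc 0..<Suc ?N]" by simp
  have sum: "(\<Sum>k=i..qlast. (m k - \<rho> k) * hc k) = (?N - 0) * hc i + (\<Sum>k=Suc i..qlast. (m k - \<rho> k) * hc k)"
    using less.prems(2) by (simp add: sum.atLeast_Suc_atMost)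
  show ?case unfolding list find_last_factor.simps v0 one sum add.assoc
  proof (rule computes_bind[OF computes_multiply_until_zero[OF i]], goal_cases)
    case (1 p)
    obtain v' stop where p: "p = (v', stop)" by fastforce
    show ?case
    proof (cases stop)
      case None
      have "v' = W (b(i := b i + ?N))" using 1 by (simp add: p None max_def del: fun_upd_apply)
      also have "\<dots> = W (stored q i)"
        using \<rho>m bi by (intro w_cong) (auto simp: b_def stored_def)
      finally have v': "v' = W (stored q (Suc i - 1))" by simp
      have nz: "\<forall>l\<in>{0<..?N}. v l \<noteq> 0\<^sub>v n"
        using 1 by (simp add: p None v_def del: fun_upd_apply)
      then have "v ?N \<noteq> 0\<^sub>v n"
        using \<open>v 0 \<noteq> 0\<^sub>v n\<close> by (cases "?N = 0") auto
      \<comment> \<open>Factor i now has its full multiplicity, so a nonzero vector shows that a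
        deficient factor lies further on.\<close>
      then have "qlast \<noteq> i" using zero_iff[of ?N] r_le[OF i, of j] \<rho>m by auto
      then have "computes (find_last_factor [Suc i..<Suc q] A f m \<rho> v' (vs(i := v')) \<rho>)
          (\<lambda>(i', st). i' = qlast \<and> settled (qlast - 1) st)
          ((\<Sum>k=Suc i..qlast. (m k - \<rho> k) * hc k) + qlast * (\<delta> qlast * hc qlast))"
        using less.prems unfolding v'
        by (intro less.hyps) (auto simp: less_Suc_eq)
      then show ?thesis by (simp add: p None del: upt_Suc)
    next
      case (Some l)
      have l: "0 < l" "l \<le> ?N" "v l = 0\<^sub>v n" and nz: "\<And>l'. 0 < l' \<Longrightarrow> l' < l \<Longrightarrow> v l' \<noteq> 0\<^sub>v n"
        using 1 by (simp_all add: p Some v_def del: fun_upd_apply)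
      then have q: "qlast = i" and rl: "r i j \<le> \<rho> i + l" using zero_iff by auto
      \<comment> \<open>The preceding vector was tested nonzero or, for l = 1, is the starting
        vector. Hence l is exactly \<open>\<delta> i\<close>.\<close>
      have "v (l - 1) \<noteq> 0\<^sub>v n" using nz[of "l - 1"] l \<open>v 0 \<noteq> 0\<^sub>v n\<close> by (cases "l = 1") auto
      then have "\<not> r i j \<le> \<rho> i + (l - 1)" using zero_iff[of "l - 1"] l q by auto
      then have r: "r i j = \<rho> i + l" using rl l by simp
      have U: "computes (update_stored A (f i) l (rev [0..<i]) (vs(i := 0\<^sub>v n)))
          (\<lambda>vs'. \<forall>s. vs' s = (if s \<in> set (rev [0..<i]) then W ((stored q s)(i := stored q s i + l)) else (vs(i := 0\<^sub>v n)) s))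
          (length (rev [0..<i]) * (l * hc i))"
        by (rule computes_update_stored[OF i]) (use less.prems(3) in auto)
      have upd: "W ((stored q s)(i := stored q s i + l)) = W (stored (i - 1) s)" if "s < i - 1" for s
        using that i r qlast_less q by (intro w_cong) (auto simp: stored_def)
      \<comment> \<open>Factors above \<open>qlast\<close> count as settled because \<open>r\<close>
        and \<open>\<rho>\<close> agree there.\<close>
      have settled: "settled (i - 1) (vs', \<rho>(i := \<rho> i + l))"
        if "\<forall>s. vs' s = (if s \<in> set (rev [0..<i]) then W ((stored q s)(i := stored q s i + l)) else (vs(i := 0\<^sub>v n)) s)" for vs'
        using that upd i r q qlast_less by (auto simp: settled_def simp del: fun_upd_apply) (auto simp: not_less)
      have cost: "i * (l * hc i) + 0 \<le> (\<Sum>k=Suc i..qlast. (m k - \<rho> k) * hc k) + qlast * (\<delta> qlast * hc qlast)"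
        using q r by simp
      show ?thesis unfolding p Some prod.case option.case dim
        by (rule computes_bind_le[OF U, where b = 0])
          (use settled q cost in \<open>auto intro!: computes_return simp del: fun_upd_apply\<close>)
    qed
  qed
qed

text \<open>The loop tests before each product, so only indices below N must be nonzero. The vector
  may vanish through the very last product, and then no update happens.\<close>

lemma computes_exponent_loop_nonzero:
  assumes i: "i \<in> {1..q}" and "l \<le> N"
    and "\<And>l'. l \<le> l' \<Longrightarrow> l' < N \<Longrightarrow> W (b(i := b i + l')) \<noteq> 0\<^sub>v n"
  shows "computes (exponent_loop [l..<N] A (f i) i (W (b(i := b i + l))) vs \<epsilon>)
    (\<lambda>p. p = (vs, \<epsilon>(i := \<epsilon> i + (N - l)))) ((N - l) * hc i)"
  using assms(2-)
proof (induction "N - l" arbitrary: l \<epsilon>)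
  case 0
  then show ?case by (simp add: computes_return)
next
  case (Suc d)
  then have list: "[l..<N] = l # [Suc l..<N]" by (simp add: upt_conv_Cons)
  have H: "computes (horner (f i) A (W (b(i := b i + l)))) (\<lambda>y. y = W (b(i := b i + Suc l))) (hc i)"
    using computes_horner_W[OF i, of "b(i := b i + l)"] by simp
  have cost: "hc i + (N - Suc l) * hc i = (N - l) * hc i"
    using Suc.hyps(2) by (simp add: Suc_diff_Suc flip: mult_Suc)
  have nz: "(W (b(i := b i + l)) = 0\<^sub>v (dim_row A)) = False" using Suc.prems(2)[of l] Suc.hyps(2) A by simp
  let ?e = "\<epsilon>(i := \<epsilon> i + 1)"
  have e: "?e(i := ?e i + (N - Suc l)) = \<epsilon>(i := \<epsilon> i + (N - l))" using Suc.hyps(2) by (intro ext) auto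
  have IH: "computes (exponent_loop [Suc l..<N] A (f i) i (W (b(i := b i + Suc l))) vs ?e)
      (\<lambda>p. p = (vs, ?e(i := ?e i + (N - Suc l)))) ((N - Suc l) * hc i)"
    using Suc.hyps(2) Suc.prems by (intro Suc.hyps(1)) auto
  show ?case unfolding list exponent_loop.simps nz if_False cost[symmetric]
    by (rule computes_bind[OF H]) (use IH in \<open>simp only: e\<close>)
qed

text \<open>The pass that notices the zero makes no further product with v, so the cost is
  independent of N and the pass added by \<open>extra = 1\<close> is free apart from the
  update.\<close>

lemma computes_exponent_loop_zero:
  assumes i: "i \<in> {1..q}" and "l \<le> t" "t < N"
    and "\<And>l'. l \<le> l' \<Longrightarrow> l' < t \<Longrightarrow> W (b(i := b i + l')) \<noteq> 0\<^sub>v n"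
    and zero: "W (b(i := b i + t)) = 0\<^sub>v n"
    and vs: "\<And>s. s < i - 1 \<Longrightarrow> vs s = W (bs s)"
  shows "computes (exponent_loop [l..<N] A (f i) i (W (b(i := b i + l))) vs \<epsilon>)
    (\<lambda>(vs', e'). (\<forall>s<i - 1. vs' s = W ((bs s)(i := bs s i + t))) \<and> e' = \<epsilon>(i := \<epsilon> i + (t - l)))
    ((t - l) * hc i + (i - 1) * (t * hc i))"
  using assms(2-4)
proof (induction "t - l" arbitrary: l \<epsilon>)
  case 0
  then have list: "[t..<N] = t # [Suc t..<N]" and t: "l = t" by (simp_all add: upt_conv_Cons)
  have z: "(W (b(i := b i + t)) = 0\<^sub>v (dim_row A)) = True" using zero A by simp
  have U: "computes (update_stored A (f i) t (rev [0..<i - 1]) vs)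
      (\<lambda>vs'. \<forall>s. vs' s = (if s \<in> set (rev [0..<i - 1]) then W ((bs s)(i := bs s i + t)) else vs s))
      (length (rev [0..<i - 1]) * (t * hc i))"
    by (rule computes_update_stored[OF i]) (use vs in auto)
  show ?case unfolding t list exponent_loop.simps z if_True
    by (rule computes_bind_le[OF U, where b = 0])
      (auto intro!: computes_return simp del: fun_upd_apply)
next
  case (Suc d)
  then have list: "[l..<N] = l # [Suc l..<N]" by (simp add: upt_conv_Cons)
  have H: "computes (horner (f i) A (W (b(i := b i + l)))) (\<lambda>y. y = W (b(i := b i + Suc l))) (hc i)"
    using computes_horner_W[OF i, of "b(i := b i + l)"] by simp
  have cost: "hc i + ((t - Suc l) * hc i + (i - 1) * (t * hc i)) = (t - l) * hc i + (i - 1) * (t * hc i)"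
    using Suc.hyps(2) by (simp add: Suc_diff_Suc flip: mult_Suc add.assoc)
  have nz: "(W (b(i := b i + l)) = 0\<^sub>v (dim_row A)) = False" using Suc.prems(3)[of l] Suc.hyps(2) A by simp
  let ?e = "\<epsilon>(i := \<epsilon> i + 1)"
  have e: "?e(i := ?e i + (t - Suc l)) = \<epsilon>(i := \<epsilon> i + (t - l))" using Suc.hyps(2) by (intro ext) auto
  have IH: "computes (exponent_loop [Suc l..<N] A (f i) i (W (b(i := b i + Suc l))) vs ?e)
      (\<lambda>(vs', e'). (\<forall>s<i - 1. vs' s = W ((bs s)(i := bs s i + t))) \<and> e' = ?e(i := ?e i + (t - Suc l)))
      ((t - Suc l) * hc i + (i - 1) * (t * hc i))"
    using Suc.hyps(2) Suc.prems by (intro Suc.hyps(1)) auto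
  show ?case unfolding list exponent_loop.simps nz if_False cost[symmetric]
    by (rule computes_bind[OF H]) (use IH in \<open>simp only: e\<close>)
qed


text \<open>
  After a missed update every stored vector lacks a factor that is no longer multiplied in, so no
  vector vanishes from then on. In particular no update takes place, which bounds the cost.
\<close>

definition stuck :: "nat \<Rightarrow> (nat \<Rightarrow> 'a vec) \<times> (nat \<Rightarrow> nat) \<Rightarrow> bool" where
  "stuck k = (\<lambda>(vs, _). \<forall>s<k. \<exists>b. vs s = W b \<and> (\<exists>x\<in>{k<..q}. b x < r x j))"

text \<open>The zero goes unnoticed when it appears after the last pass, that is for
  \<open>r k j = m k\<close>. This is harmless for k = 1, where no vector is left to update, and for
  \<open>\<rho> k = r k j\<close>, where the update would change nothing.\<close>

definition missed :: bool where
  "missed \<longleftrightarrow> \<not> (\<forall>k\<in>{2..<qlast}. \<rho> k < r k j \<longrightarrow> r k j < m k)"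

definition exponent_state :: "nat \<Rightarrow> nat \<Rightarrow> (nat \<Rightarrow> 'a vec) \<times> (nat \<Rightarrow> nat) \<Rightarrow> bool" where
  "exponent_state extra k st \<longleftrightarrow> settled k st \<or> extra = 0 \<and> missed \<and> stuck k st"

text \<open>The k-th summand of the bound, with \<open>hc k\<close> for n^2 d_k. The first part pays
  for a full run without update, the second for a run that ends with one.\<close>

definition step_cost :: "nat \<Rightarrow> nat" where
  "step_cost k = (m k - \<rho> k) * hc k + k * (\<delta> k * hc k)"

lemma computes_exponent_loop_stuck:
  assumes k: "k \<in> {1..q}" and stuck: "stuck k (vs, \<epsilon>)"
  shows "computes (exponent_loop [0..<m k - \<rho> k] A (f k) k (vs (k - 1)) vs \<epsilon>)
    (stuck (k - 1)) (step_cost k)"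
proof -
  have "k - 1 < k" using k by auto
  then obtain b x where b: "vs (k - 1) = W b" and x: "x \<in> {k<..q}" "b x < r x j"
    using stuck unfolding stuck_def by blast
  \<comment> \<open>The deficient exponent belongs to some x > k and is not changed by products with
    \<open>f k\<close>.\<close>
  have nz: "W (b(k := b k + l)) \<noteq> 0\<^sub>v n" for l
    using x k by (auto simp: w_eq_0_iff not_le intro!: bexI[of _ x])
  have "\<exists>b. vs s = W b \<and> (\<exists>x\<in>{k - 1<..q}. b x < r x j)" if "s < k - 1" for s
  proof -
    have "s < k" using that by simp
    then obtain b' x where "vs s = W b'" "x \<in> {k<..q}" "b' x < r x j"
      using stuck unfolding stuck_def by blast
    then show ?thesis by (intro exI[of _ b'] conjI bexI[of _ x]) auto
  qed
  then have "stuck (k - 1) (vs, \<epsilon>')" for \<epsilon>' by (simp add: stuck_def)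
  moreover have "vs (k - 1) = W (b(k := b k + 0))" using b by simp
  ultimately show ?thesis
    using computes_exponent_loop_nonzero[OF k, of 0 "m k - \<rho> k" b vs \<epsilon>] nz
    by (auto simp: step_cost_def elim!: computes_mono)
qed

lemma computes_exponent_loop_settled:
  assumes k: "k \<in> {1..<qlast}" and settled: "settled k (vs, \<epsilon>)"
  shows "computes (exponent_loop [0..<m k - \<rho> k + extra] A (f k) k (vs (k - 1)) vs \<epsilon>)
    (exponent_state extra (k - 1)) (step_cost k)"
proof -
  let ?N = "m k - \<rho> k + extra"
  define b where "b = stored k (k - 1)"
  have kq: "k \<in> {1..q}" using k qlast_le by auto
  have le: "\<rho> k \<le> r k j" "r k j \<le> m k" using \<rho>_le[OF kq] r_le[OF kq, of j] by auto
  have vs: "vs s = W (stored k s)" if "s < k" for s using settled that by (simp add: settled_def)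
  have \<epsilon>: "\<epsilon> x = (if k < x then r x j else \<rho> x)" if "x \<in> {1..q}" for x
    using settled that by (simp add: settled_def)
  have bk: "b k = \<rho> k" using k by (auto simp: b_def stored_def)
  have v0: "vs (k - 1) = W (b(k := b k + 0))" using vs[of "k - 1"] k by (simp add: b_def)
  have zero_iff: "W (b(k := b k + l)) = 0\<^sub>v n \<longleftrightarrow> \<delta> k \<le> l" for l
  proof -
    have "r x j \<le> (b(k := b k + l)) x" if "x \<in> {1..q}" "x \<noteq> k" for x
      using that r_le[OF that(1), of j] by (auto simp: b_def stored_def)
    then show ?thesis using kq bk unfolding w_eq_0_iff by (metis fun_upd_same le_diff_conv add.commute)
  qed
  have \<epsilon>': "(\<epsilon>(k := \<epsilon> k + \<delta> k)) x = (if k - 1 < x then r x j else \<rho> x)" if "x \<in> {1..q}" for x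
    using \<epsilon>[OF that] k le by auto
  have upd: "W ((stored k s)(k := stored k s k + \<delta> k)) = W (stored (k - 1) s)" if "s < k - 1" for s
    using that le by (intro w_cong) (auto simp: stored_def)
  show ?thesis
  proof (cases "\<delta> k < ?N")
    case True
    have "computes (exponent_loop [0..<?N] A (f k) k (W (b(k := b k + 0))) vs \<epsilon>)
      (\<lambda>(vs', e'). (\<forall>s<k - 1. vs' s = W ((stored k s)(k := stored k s k + \<delta> k))) \<and> e' = \<epsilon>(k := \<epsilon> k + (\<delta> k - 0)))
      ((\<delta> k - 0) * hc k + (k - 1) * (\<delta> k * hc k))"
      by (rule computes_exponent_loop_zero[OF kq]) (use True zero_iff vs in auto)
    then show ?thesis unfolding v0
    proof (rule computes_mono, goal_cases)
      case (1 st)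
      then have "settled (k - 1) st" using \<epsilon>' upd unfolding settled_def by (auto simp del: fun_upd_apply)
      then show ?case by (simp add: exponent_state_def)
    next
      case 2
      \<comment> \<open>One share of \<open>\<delta> k\<close> products for the working vector and k
        - 1 shares for the stored ones.\<close>
      have "\<delta> k * hc k + (k - 1) * (\<delta> k * hc k) = k * (\<delta> k * hc k)"
        using k by (metis atLeastLessThan_iff mult_eq_if not_one_le_zero)
      then show ?case by (simp add: step_cost_def)
    qed
  next
    case False
    then have \<delta>: "\<delta> k = m k - \<rho> k" "extra = 0" "r k j = m k" using le by auto
    have "computes (exponent_loop [0..<?N] A (f k) k (W (b(k := b k + 0))) vs \<epsilon>)
        (\<lambda>p. p = (vs, \<epsilon>(k := \<epsilon> k + (?N - 0)))) ((?N - 0) * hc k)"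
      by (rule computes_exponent_loop_nonzero[OF kq]) (use \<delta> zero_iff in auto)
    moreover have "exponent_state extra (k - 1) (vs, \<epsilon>(k := \<epsilon> k + \<delta> k))"
    proof (cases "k = 1 \<or> \<delta> k = 0")
      case True
      then have "settled (k - 1) (vs, \<epsilon>(k := \<epsilon> k + \<delta> k))"
        using \<epsilon>' upd vs unfolding settled_def by (auto simp del: fun_upd_apply)
      then show ?thesis by (simp add: exponent_state_def)
    next
      case False
      then have "missed" using k \<delta> le by (auto simp: missed_def intro!: bexI[of _ k])
      moreover have "stuck (k - 1) (vs, \<epsilon>')" for \<epsilon>'
      proof -
        \<comment> \<open>The missing factor is k itself: without the update its exponent in
          \<open>vs s\<close> is still \<open>\<rho> k\<close>, below \<open>r k j\<close>.\<close>
        have "\<exists>b. vs s = W b \<and> (\<exists>x\<in>{k - 1<..q}. b x < r x j)" if "s < k - 1" for s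
          using that vs[of s] False kq le
          by (intro exI[of _ "stored k s"] conjI bexI[of _ k]) (auto simp: stored_def)
        then show ?thesis by (simp add: stuck_def)
      qed
      ultimately show ?thesis using \<delta> by (simp add: exponent_state_def)
    qed
    ultimately show ?thesis unfolding v0 using \<delta>
      by (auto simp: step_cost_def elim!: computes_mono simp del: fun_upd_apply)
  qed
qed

lemma computes_find_exponents:
  assumes "qlast \<noteq> 0" "settled (qlast - 1) (vs, \<epsilon>)"
  shows "computes (find_exponents extra A f m \<rho> qlast vs \<epsilon>)
    (\<lambda>e'. extra = 0 \<and> missed \<or> (\<forall>x\<in>{1..q}. e' x = r x j)) (\<Sum>k=1..<qlast. step_cost k)"
proof -
  let ?ks = "rev [1..<qlast]"
  let ?body = "\<lambda>k (vs, r). exponent_loop [0..<m k - \<rho> k + extra] A (f k) k (vs (k - 1)) vs r"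
  have "computes (for_each ?ks ?body (vs, \<epsilon>)) (exponent_state extra (qlast - 1 - length ?ks))
      (\<Sum>t<length ?ks. step_cost (qlast - 1 - t))"
  proof (rule computes_for_each[where I = "\<lambda>t. exponent_state extra (qlast - 1 - t)"])
    show "exponent_state extra (qlast - 1 - 0) (vs, \<epsilon>)" using assms(2) by (simp add: exponent_state_def)
    fix t st assume t: "t < length ?ks" and I: "exponent_state extra (qlast - 1 - t) st"
    define k where "k = qlast - 1 - t"
    have k: "k \<in> {1..<qlast}" "?ks ! t = k" "qlast - 1 - Suc t = k - 1"
      using t by (auto simp: rev_nth k_def)
    obtain vs' e' where st: "st = (vs', e')" by fastforce
    have "computes (?body k st) (exponent_state extra (k - 1)) (step_cost k)"
    proof (cases "settled k st")
      case True
      then show ?thesis using computes_exponent_loop_settled[OF k(1)] by (simp add: st)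
    next
      case False
      then have "extra = 0" "missed" "stuck k st" using I by (auto simp: exponent_state_def k_def)
      moreover have "k \<in> {1..q}" using k(1) qlast_le by auto
      ultimately show ?thesis using computes_exponent_loop_stuck[of k vs' e']
        by (auto simp: st exponent_state_def elim: computes_mono)
    qed
    then show "computes (?body (?ks ! t) st) (exponent_state extra (qlast - 1 - Suc t)) (step_cost (qlast - 1 - t))"
      unfolding k by (simp only: k_def)
  qed
  moreover have "(\<Sum>t<qlast - 1. step_cost (qlast - 1 - t)) = (\<Sum>k=1..<qlast. step_cost k)"
    by (rule sum.reindex_bij_witness[of _ "\<lambda>k. qlast - 1 - k" "\<lambda>t. qlast - 1 - t"]) auto
  ultimately have L: "computes (for_each ?ks ?body (vs, \<epsilon>)) (exponent_state extra 0) (\<Sum>k=1..<qlast. step_cost k)"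
    by simp
  show ?thesis unfolding find_exponents_def
    by (rule computes_bind_le[OF L, where b = 0])
      (auto intro!: computes_return simp: exponent_state_def settled_def)
qed

text \<open>The summands belong to forming the pseudo annihilating polynomial, applying it to the
  unit vector, step (2) with its update, and step (3).\<close>

definition column_cost :: nat where
  "column_cost = (\<Sum>i=1..q. \<rho> i * ((degree (f i) + 1) * (2 * (n + 1))))
     + (horner_cost n (\<Sum>i=1..q. \<rho> i * degree (f i))
     + (((\<Sum>k=1..qlast. (m k - \<rho> k) * hc k) + qlast * (\<delta> qlast * hc qlast))
     + (\<Sum>k=1..<qlast. step_cost k)))"

lemma computes_unit_exponents:
  "computes (unit_exponents extra A q f m \<rho> j)
    (\<lambda>e'. extra = 0 \<and> missed \<or> (\<forall>x\<in>{1..q}. e' x = r x j)) column_cost"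
proof -
  have dim: "dim_row A = n" using A by simp
  have sum_le: "(\<Sum>i=1..t. \<rho> i * degree (f i)) \<le> n" if "t \<le> q" for t
  proof -
    have "(\<Sum>i=1..t. \<rho> i * degree (f i)) \<le> (\<Sum>i=1..t. m i * degree (f i))"
      using that \<rho>_le r_le le_trans by (intro sum_mono mult_right_mono) fastforce+
    also have "\<dots> \<le> (\<Sum>i=1..q. m i * degree (f i))" using that by (intro sum_mono2) auto
    finally show ?thesis using sum_degrees by simp
  qed
  have deg: "degree (\<Prod>i=1..t. f i ^ \<rho> i) = (\<Sum>i=1..t. \<rho> i * degree (f i))" if "t \<le> q" for t
    using that monic by (intro degree_prod_monic_powers) auto
  have "computes (for_each [1..<Suc q] (\<lambda>i s. poly_mult_power (f i) (\<rho> i) s) 1)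
      (\<lambda>p. p = (\<Prod>i=1..length [1..<Suc q]. f i ^ \<rho> i))
      (\<Sum>t<length [1..<Suc q]. \<rho> (Suc t) * ((degree (f (Suc t)) + 1) * (2 * (n + 1))))"
  proof (rule computes_for_each[where I = "\<lambda>t p. p = (\<Prod>i=1..t. f i ^ \<rho> i)"])
    fix t s assume t: "t < length [1..<Suc q]" and s: "s = (\<Prod>i=1..t. f i ^ \<rho> i)"
    have tq: "t < q" using t by (simp del: upt_Suc)
    then have nth: "[1..<Suc q] ! t = Suc t" by (subst nth_upt) auto
    have nz: "f i \<noteq> 0" if "i \<in> {1..q}" for i using irred[OF that] by auto
    have eq: "f (Suc t) ^ \<rho> (Suc t) * s = (\<Prod>i=1..Suc t. f i ^ \<rho> i)" by (simp add: s mult.commute)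
    have "computes (poly_mult_power (f (Suc t)) (\<rho> (Suc t)) s) (\<lambda>p. p = f (Suc t) ^ \<rho> (Suc t) * s)
        (\<rho> (Suc t) * ((degree (f (Suc t)) + 1) * (2 * (n + 1))))"
    proof (rule computes_poly_mult_power)
      show "f (Suc t) \<noteq> 0" "s \<noteq> 0" using nz tq by (auto simp: s)
      show "degree (f (Suc t) ^ \<rho> (Suc t) * s) \<le> n"
        unfolding eq using deg[of "Suc t"] sum_le[of "Suc t"] tq by simp
    qed
    then show "computes (poly_mult_power (f ([1..<Suc q] ! t)) (\<rho> ([1..<Suc q] ! t)) s)
        (\<lambda>p. p = (\<Prod>i=1..Suc t. f i ^ \<rho> i)) (\<rho> (Suc t) * ((degree (f (Suc t)) + 1) * (2 * (n + 1))))"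
      unfolding nth eq .
  qed simp
  moreover have "(\<Sum>t<q. \<rho> (Suc t) * ((degree (f (Suc t)) + 1) * (2 * (n + 1))))
      = (\<Sum>i=1..q. \<rho> i * ((degree (f i) + 1) * (2 * (n + 1))))"
    by (rule sum.reindex_bij_witness[of _ "\<lambda>i. i - 1" Suc]) auto
  ultimately have P: "computes (for_each [1..<Suc q] (\<lambda>i s. poly_mult_power (f i) (\<rho> i) s) 1)
      (\<lambda>p. p = (\<Prod>i=1..q. f i ^ \<rho> i)) (\<Sum>i=1..q. \<rho> i * ((degree (f i) + 1) * (2 * (n + 1))))"
    by (simp del: upt_Suc)
  have W: "W \<rho> = W (stored q 0)" by (rule w_cong) (auto simp: stored_def)
  have H: "computes (horner (\<Prod>i=1..q. f i ^ \<rho> i) A (unit_vec n j)) (\<lambda>v. v = W \<rho>)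
      (horner_cost n (\<Sum>i=1..q. \<rho> i * degree (f i)))"
    using computes_horner[OF A unit_vec_carrier, of "\<Prod>i=1..q. f i ^ \<rho> i" j] deg[of q] by (simp add: w_def)
  have rest: "computes (if W \<rho> = 0\<^sub>v n then ret \<rho>
     else do {
       (i, vs, r) \<leftarrow> find_last_factor [1..<Suc q] A f m \<rho> (W \<rho>) (\<lambda>_. W \<rho>) \<rho>;
       find_exponents extra A f m \<rho> i vs r })
    (\<lambda>e'. extra = 0 \<and> missed \<or> (\<forall>x\<in>{1..q}. e' x = r x j))
    (((\<Sum>k=1..qlast. (m k - \<rho> k) * hc k) + qlast * (\<delta> qlast * hc qlast)) + (\<Sum>k=1..<qlast. step_cost k))"
  proof (cases "qlast = 0")
    case True
    then have "W \<rho> = 0\<^sub>v n" using W_stored_q_eq_0_iff[of 0] W by simp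
    moreover have "\<forall>x\<in>{1..q}. \<rho> x = r x j" using qlast_less True by simp
    ultimately show ?thesis by (simp add: computes_return)
  next
    case False
    then have nz: "W \<rho> \<noteq> 0\<^sub>v n" using W_stored_q_eq_0_iff[of 0] W by simp
    have F: "computes (find_last_factor [1..<Suc q] A f m \<rho> (W \<rho>) (\<lambda>_. W \<rho>) \<rho>)
        (\<lambda>(i', st). i' = qlast \<and> settled (qlast - 1) st)
        ((\<Sum>k=1..qlast. (m k - \<rho> k) * hc k) + qlast * (\<delta> qlast * hc qlast))"
      using computes_find_last_factor[of 1 "\<lambda>_. W \<rho>"] False W by (simp del: upt_Suc)
    show ?thesis using nz
      by (simp only: if_False)
        (rule computes_bind[OF F], use computes_find_exponents[OF False] in auto)
  qed
  show ?thesis unfolding unit_exponents_def column_cost_def dim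
    by (rule computes_bind[OF P], simp only:, rule computes_bind[OF H], simp only:, rule rest)
qed


text \<open>12 = 8 + 4 for forming the polynomial and applying it. 10 = 2 * 5 because steps (2) and
  (3) together cost at most twice the sum of \<open>step_cost\<close>, and 5 is the constant of
  \<open>horner_cost_le\<close>.\<close>

lemma column_cost_le:
  "column_cost \<le> n + 12 * (n\<^sup>2 * (\<Sum>i=1..q. \<rho> i * degree (f i)))
     + 10 * (n\<^sup>2 * (\<Sum>k=1..qlast. degree (f k) * ((m k - \<rho> k) + k * \<delta> k)))"
proof -
  let ?P = "\<Sum>i=1..q. \<rho> i * degree (f i)"
  let ?S = "\<Sum>k=1..qlast. degree (f k) * ((m k - \<rho> k) + k * \<delta> k)"
  have "(\<Sum>i=1..q. \<rho> i * ((degree (f i) + 1) * (2 * (n + 1)))) \<le> (\<Sum>i=1..q. 8 * n * (\<rho> i * degree (f i)))"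
  proof (rule sum_mono)
    fix i assume i: "i \<in> {1..q}"
    have "\<rho> i * ((degree (f i) + 1) * (2 * (n + 1))) \<le> \<rho> i * ((2 * degree (f i)) * (2 * (2 * n)))"
      using degree_f_pos[OF i] n_pos by (intro mult_le_mono) auto
    then show "\<rho> i * ((degree (f i) + 1) * (2 * (n + 1))) \<le> 8 * n * (\<rho> i * degree (f i))"
      by (simp add: algebra_simps)
  qed
  also have "\<dots> = 8 * (n * ?P)" by (simp add: sum_distrib_left mult.assoc)
  also have "\<dots> \<le> 8 * (n\<^sup>2 * ?P)" using n_pos by (intro mult_le_mono) (auto simp: power2_eq_square)
  finally have 1: "(\<Sum>i=1..q. \<rho> i * ((degree (f i) + 1) * (2 * (n + 1)))) \<le> 8 * (n\<^sup>2 * ?P)" .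
  have 2: "horner_cost n ?P \<le> n + 4 * (n\<^sup>2 * ?P)"
    using horner_cost_le'[of n ?P] n_pos by (simp add: mult.assoc)
  have "(\<Sum>k=1..qlast. (m k - \<rho> k) * hc k) \<le> (\<Sum>k=1..qlast. step_cost k)"
    by (rule sum_mono) (simp add: step_cost_def)
  moreover have "qlast * (\<delta> qlast * hc qlast) + (\<Sum>k=1..<qlast. step_cost k) \<le> (\<Sum>k=1..qlast. step_cost k)"
  proof (cases qlast)
    case (Suc l)
    then have "(\<Sum>k=1..qlast. step_cost k) = step_cost qlast + (\<Sum>k=1..<qlast. step_cost k)"
      by (simp add: atLeastLessThanSuc_atLeastAtMost)
    then show ?thesis by (simp add: step_cost_def)
  qed simp
  moreover have "(\<Sum>k=1..qlast. step_cost k) \<le> (\<Sum>k=1..qlast. 5 * n\<^sup>2 * (degree (f k) * ((m k - \<rho> k) + k * \<delta> k)))"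
  proof (rule sum_mono)
    fix k assume "k \<in> {1..qlast}"
    then have k: "k \<in> {1..q}" using qlast_le by auto
    have "step_cost k = ((m k - \<rho> k) + k * \<delta> k) * hc k" by (simp add: step_cost_def algebra_simps)
    also have "\<dots> \<le> ((m k - \<rho> k) + k * \<delta> k) * (5 * n\<^sup>2 * degree (f k))"
      using n_pos degree_f_pos[OF k] by (intro mult_le_mono2 horner_cost_le) auto
    finally show "step_cost k \<le> 5 * n\<^sup>2 * (degree (f k) * ((m k - \<rho> k) + k * \<delta> k))"
      by (simp only: ac_simps)
  qed
  moreover have "\<dots> = 5 * (n\<^sup>2 * ?S)" by (simp only: sum_distrib_left mult.assoc)
  ultimately show ?thesis using 1 2 unfolding column_cost_def by linarith
qed

end

section \<open>Algorithm M over all columns and the final bound\<close>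

context factored_matrix
begin

lemma computes_min_annihilators_gen:
  assumes u: "u \<in> carrier_vec n"
  defines "\<rho> \<equiv> result_of (pseudo_annihilators A q f m u)"
  shows "computes (min_annihilators_gen extra A q f m u)
    (\<lambda>r'. \<forall>j<n. extra = 0 \<and> column.missed A q f m j (\<lambda>i. \<rho> i j) \<or> (\<forall>i\<in>{1..q}. r' i j = r i j))
    ((\<Sum>i=1..q. pseudo_cost i) + (\<Sum>j<n. column.column_cost n A q f m j (\<lambda>i. \<rho> i j)))"
proof -
  note P = computes_pseudo_annihilators[OF u]
  have col: "column n A q f m j (\<lambda>i. \<rho> i j)" if "j < n" for j
    using computes_result[OF P] that by unfold_locales (auto simp: \<rho>_def)
  let ?body = "\<lambda>j r. do {
          e \<leftarrow> unit_exponents extra A q f m (\<lambda>i. \<rho> i j) j;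
          ret (\<lambda>i. (r i)(j := e i)) }"
  let ?ok = "\<lambda>j r'. extra = 0 \<and> column.missed A q f m j (\<lambda>i. \<rho> i j) \<or> (\<forall>i\<in>{1..q}. r' i j = r i j)"
  have L: "computes (for_each [0..<n] ?body \<rho>) (\<lambda>r'. \<forall>j<length [0..<n]. ?ok j r')
      (\<Sum>j<length [0..<n]. column.column_cost n A q f m j (\<lambda>i. \<rho> i j))"
  proof (rule computes_for_each[where I = "\<lambda>t r'. \<forall>j<t. ?ok j r'"])
    fix t r' assume t: "t < length [0..<n]" and I: "\<forall>j<t. ?ok j r'"
    then have nth: "[0..<n] ! t = t" and "t < n" by auto
    note U = column.computes_unit_exponents[OF col[OF \<open>t < n\<close>], of extra]
    show "computes (?body ([0..<n] ! t) r') (\<lambda>r'. \<forall>j<Suc t. ?ok j r')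
        (column.column_cost n A q f m t (\<lambda>i. \<rho> i t))"
      unfolding nth by (rule computes_bind_le[OF U, where b = 0])
        (use I in \<open>auto intro!: computes_return simp: less_Suc_eq\<close>)
  qed simp
  have dim: "dim_row A = n" using A by simp
  show ?thesis unfolding min_annihilators_gen_def dim
    by (rule computes_bind[OF computes_eq_result[OF P]]) (use L in \<open>simp add: \<rho>_def\<close>)
qed

end

text \<open>C is chosen before the size, the matrix, its factorization and u, which is what the
  O-notation means. The cost claim is unconditional for both variants of the loop; the exponents of
  the original variant are claimed under the negation of \<open>missed\<close>.\<close>

theorem proposition6:
  shows "\<exists>C::real. \<forall>(n::nat) (A :: 'a::field_char_0 mat) q f m u.
    A \<in> carrier_mat n n \<longrightarrow>
    irreducible_factorization (char_poly A) q f m \<longrightarrow>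
    u \<in> carrier_vec n \<longrightarrow> u \<noteq> 0\<^sub>v n \<longrightarrow>
    (let
       \<rho> = result_of (pseudo_annihilators A q f m u);
       r = (\<lambda>i j. factor_exponent (f i) (unit_min_annihilator A j));
       \<delta> = (\<lambda>i j. real (r i j) - real (\<rho> i j));
       d = (\<lambda>i. real (degree (f i)));
       q'' = (\<lambda>j. Max (insert 0 {i \<in> {1..q}. \<rho> i j < r i j}));
       bound = (real q - 1) * real n ^ 3
         + real n ^ 2 * real (degree (min_polynomial A))
         + real n ^ 2 * (\<Sum>j<n. real (degree (factor_product q f \<rho> j)))
         + real n ^ 2 * (\<Sum>j<n. \<Sum>k=1..q'' j.
             d k * ((real (m k) - real (\<rho> k j)) + real k * \<delta> k j))
     in
       real (op_count (min_annihilators A q f m u)) \<le> C * bound \<and>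
       real (op_count (min_annihilators_full A q f m u)) \<le> C * bound \<and>
       (\<forall>j<n. unit_min_annihilator A j = factor_product q f r j \<and>
          ((\<forall>k\<in>{2..<q'' j}. \<rho> k j < r k j \<longrightarrow> r k j < m k) \<longrightarrow>
             (\<forall>i\<in>{1..q}. result_of (min_annihilators A q f m u) i j = r i j)) \<and>
          (\<forall>i\<in>{1..q}. result_of (min_annihilators_full A q f m u) i j = r i j)))"
proof (rule exI[of _ 28], intro allI impI, goal_cases)
  case (1 n A q f m u)
  \<comment> \<open>A nonzero u forces positive dimension. This also gives q at least 1, so that
    \<open>real q - 1\<close> is the image of the natural number q - 1.\<close>
  have "n \<noteq> 0" using 1(3,4) by (intro notI) auto
  then interpret factored_matrix n A q f m using 1 by unfold_locales auto
  define \<rho> where "\<rho> = result_of (pseudo_annihilators A q f m u)"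
  define ql where "ql j = Max (insert 0 {i \<in> {1..q}. \<rho> i j < r i j})" for j
  define P where "P j = (\<Sum>i=1..q. \<rho> i j * degree (f i))" for j
  define S where "S j = (\<Sum>k=1..ql j. degree (f k) * ((m k - \<rho> k j) + k * (r k j - \<rho> k j)))" for j
  have col: "column n A q f m j (\<lambda>i. \<rho> i j)" if "j < n" for j
    using computes_result[OF computes_pseudo_annihilators[OF 1(3)]] that
    by unfold_locales (auto simp: \<rho>_def)
  have ql: "column.qlast A q f j (\<lambda>i. \<rho> i j) = ql j" if "j < n" for j
    unfolding ql_def column.qlast_def[OF col[OF that]] ..
  have missed: "column.missed A q f m j (\<lambda>i. \<rho> i j) \<longleftrightarrow>
      \<not> (\<forall>k\<in>{2..<ql j}. \<rho> k j < r k j \<longrightarrow> r k j < m k)" if "j < n" for j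
    unfolding column.missed_def[OF col[OF that]] ql[OF that] ..
  note run = computes_min_annihilators_gen[OF 1(3), folded \<rho>_def]
  define N where "N = (q - 1) * n ^ 3 + n\<^sup>2 * degree (min_polynomial A)
    + n\<^sup>2 * (\<Sum>j<n. P j) + n\<^sup>2 * (\<Sum>j<n. S j)"
  have "(\<Sum>j<n. column.column_cost n A q f m j (\<lambda>i. \<rho> i j))
      \<le> (\<Sum>j<n. n + 12 * (n\<^sup>2 * P j) + 10 * (n\<^sup>2 * S j))"
  proof (rule sum_mono)
    fix j assume "j \<in> {..<n}"
    then have j: "j < n" by simp
    show "column.column_cost n A q f m j (\<lambda>i. \<rho> i j) \<le> n + 12 * (n\<^sup>2 * P j) + 10 * (n\<^sup>2 * S j)"
      using column.column_cost_le[OF col[OF j]] unfolding P_def S_def ql[OF j] .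
  qed
  also have "\<dots> = n\<^sup>2 * 1 + 12 * (n\<^sup>2 * (\<Sum>j<n. P j)) + 10 * (n\<^sup>2 * (\<Sum>j<n. S j))"
    by (simp add: sum.distrib sum_distrib_left power2_eq_square)
  also have "\<dots> \<le> n\<^sup>2 * degree (min_polynomial A) + 12 * (n\<^sup>2 * (\<Sum>j<n. P j)) + 10 * (n\<^sup>2 * (\<Sum>j<n. S j))"
    using degree_min_polynomial_pos by (intro add_mono mult_le_mono order.refl)
  \<comment> \<open>28 = 27 + 1: Algorithm P contributes 27 to the term with the minimal polynomial,
    and the n operations left over in each of the n columns contribute 1. The other terms have
    smaller constants.\<close>
  finally have "(\<Sum>i=1..q. pseudo_cost i) + (\<Sum>j<n. column.column_cost n A q f m j (\<lambda>i. \<rho> i j)) \<le> 28 * N"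
    using sum_pseudo_cost_le unfolding N_def by simp
  then have "op_count (min_annihilators_gen extra A q f m u) \<le> 28 * N" for extra
    using computes_op_count[OF run] le_trans by blast
  then have cost: "real (op_count (min_annihilators_gen extra A q f m u)) \<le> 28 * real N" for extra
    by (metis of_nat_le_iff of_nat_mult of_nat_numeral)
  have deg: "degree (factor_product q f \<rho> j) = P j" for j
    unfolding factor_product_def P_def using monic by (intro degree_prod_monic_powers) auto
  \<comment> \<open>Truncated subtraction agrees with subtraction of reals here because
    \<open>\<rho> k j \<le> r k j \<le> m k\<close>.\<close>
  have "real (S j) = (\<Sum>k=1..ql j. real (degree (f k)) *
      ((real (m k) - real (\<rho> k j)) + real k * (real (r k j) - real (\<rho> k j))))" if j: "j < n" for j
    unfolding S_def of_nat_sum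
  proof (rule sum.cong)
    fix k assume "k \<in> {1..ql j}"
    then have k: "k \<in> {1..q}" using column.qlast_le[OF col[OF j]] ql[OF j] by auto
    have "\<rho> k j \<le> r k j" "r k j \<le> m k" using column.\<rho>_le[OF col[OF j] k] r_le[OF k] by auto
    then show "real (degree (f k) * ((m k - \<rho> k j) + k * (r k j - \<rho> k j))) = real (degree (f k)) *
      ((real (m k) - real (\<rho> k j)) + real k * (real (r k j) - real (\<rho> k j)))"
      by simp
  qed simp
  then have N: "real N = (real q - 1) * real n ^ 3 + real n ^ 2 * real (degree (min_polynomial A))
    + real n ^ 2 * (\<Sum>j<n. real (degree (factor_product q f \<rho> j)))
    + real n ^ 2 * (\<Sum>j<n. \<Sum>k=1..ql j. real (degree (f k)) *
        ((real (m k) - real (\<rho> k j)) + real k * (real (r k j) - real (\<rho> k j))))"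
    using q_pos by (simp add: N_def deg)
  have R: "r = (\<lambda>i j. factor_exponent (f i) (unit_min_annihilator A j))"
    by (intro ext) (rule r_def)
  show ?case
    unfolding Let_def \<rho>_def[symmetric] R[symmetric] ql_def[symmetric] N[symmetric]
    using cost computes_result[OF run, of 0] computes_result[OF run, of 1] missed unit_min_annihilator_eq
    by auto
qed

end
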